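(* For every integer $d \geq 3$, both bounds in the inequalities $(d-1)(d-r-1) \leq \tau \leq (d-1)(d-r-1)+r^2$ (where $\tau=\tau(C)$, $r=r(C)$ for a reduced, singular plane curve $C$ of degree $d$) are attained: there exists a reduced, singular curve $C \subset \mathbb{P}^2$ of degree $d$ with $r(C)\geq 1$ and $\tau(C) = (d-1)(d-r(C)-1)$, and there exists a reduced, singular curve $C' \subset \mathbb{P}^2$ of degree $d$ with $r(C')\geq 1$ and $\tau(C') = (d-1)(d-r(C')-1) + r(C')^2$.
   Context: $k$ is an algebraically closed field of characteristic zero, $\mathbb{P}^2=\mathbb{P}^2_k$, $\mathcal{O}=\mathcal{O}_{\mathbb{P}^2}$. Let $C\subset\mathbb{P}^2$ be a reduced, singular curve of degree $d$ with equation $f=0$, $f \in k[x,y,z]$. The partial derivatives $f_x,f_y,f_z$ define an exact sequence $0\to E_C\to \mathcal{O}^{\oplus 3}\to \mathcal{I}_\Sigma(d-1)\to 0$, where $\Sigma$ (the jacobian scheme of $C$) is the zero-dimensional closed subscheme defined by the three partials and $E_C$ is a rank two vector bundle. The global Tjurina number of $C$ is $\tau(C):=h^0(\mathcal{O}_\Sigma)$, and $r(C):=\min\{m\in\mathbb{Z} \mid h^0(E_C(m))\neq 0\}$, i.e. the least degree of a nonzero syzygy between $f_x,f_y,f_z$. *)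

theory Defs
  imports
    "HOL-Analysis.Finite_Cartesian_Product"
    "HOL-Library.Poly_Mapping"
    "HOL-Library.Function_Algebras"
    "HOL-Computational_Algebra.Computational_Algebra"
begin

section \<open>The polynomial ring in three variables\<close>

text \<open>
  The ring \<open>k[x,y,z]\<close>: finitely supported functions from exponent vectors to \<open>k\<close>.
  The variables are indexed by the three-element type \<open>3\<close>, whose elements are \<open>1\<close>, \<open>2\<close> and \<open>3 = 0\<close>.
\<close>

type_synonym 'k mpoly3 = "(3 \<Rightarrow>\<^sub>0 nat) \<Rightarrow>\<^sub>0 'k"

definition eval3 :: "'k::field mpoly3 \<Rightarrow> 'k ^ 3 \<Rightarrow> 'k" where
  "eval3 f v = (\<Sum>m\<in>Poly_Mapping.keys f.
     Poly_Mapping.lookup f m * (\<Prod>i\<in>UNIV. (v $ i) ^ Poly_Mapping.lookup m i))"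

text \<open>
  If the variable \<open>i\<close> does not occur in the monomial \<open>m\<close>, the truncated subtraction in the exponent
  is harmless, because the coefficient is then multiplied by zero.
\<close>

definition pdiff :: "3 \<Rightarrow> 'k::field mpoly3 \<Rightarrow> 'k mpoly3" where
  "pdiff i f = (\<Sum>m\<in>Poly_Mapping.keys f.
     Poly_Mapping.single (m - Poly_Mapping.single i 1)
       (of_nat (Poly_Mapping.lookup m i) * Poly_Mapping.lookup f m))"

text \<open>
  The graded piece of degree \<open>n\<close>, for \<open>n\<close> any integer; it is zero for negative \<open>n\<close>.
  The zero polynomial is homogeneous of every degree.
\<close>

definition homogeneous :: "int \<Rightarrow> 'k::field mpoly3 \<Rightarrow> bool" where
  "homogeneous n f \<longleftrightarrow>
     (\<forall>m\<in>Poly_Mapping.keys f. int (\<Sum>i\<in>UNIV. Poly_Mapping.lookup m i) = n)"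


section \<open>The projective plane and its structure sheaf\<close>

text \<open>
  Closed points of the projective plane are represented by their sets of homogeneous coordinate
  vectors. All fields considered are algebraically closed, so working with closed points is
  sufficient.
\<close>

definition proj_plane :: "('k::field ^ 3) set set" where
  "proj_plane = {{c *s v | c. c \<noteq> 0} | v. v \<noteq> 0}"

definition vanishes_at :: "'k::field mpoly3 \<Rightarrow> ('k ^ 3) set \<Rightarrow> bool" where
  "vanishes_at f p \<longleftrightarrow> (\<forall>v\<in>p. eval3 f v = 0)"

definition zariski_open :: "('k::field ^ 3) set set \<Rightarrow> bool" where
  "zariski_open U \<longleftrightarrow> (\<exists>T. (\<forall>g\<in>T. \<exists>n. homogeneous n g) \<and>
     U = {p \<in> proj_plane. \<exists>g\<in>T. \<not> vanishes_at g p})"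

text \<open>
  The stalk at \<open>p\<close> of the sheaf associated with a homogeneous ideal \<open>I\<close>, that is, the degree zero
  part of the localization of \<open>I\<close> at \<open>p\<close>, regarded as a subset of the field of fractions of
  \<open>k[x,y,z]\<close>. The local ring at \<open>p\<close> is the case of the unit ideal.
\<close>

definition stalk :: "'k::field mpoly3 set \<Rightarrow> ('k ^ 3) set \<Rightarrow> 'k mpoly3 fract set" where
  "stalk I p = {Fract a b | a b. a \<in> I \<and>
     (\<exists>n. homogeneous n a \<and> homogeneous n b) \<and> \<not> vanishes_at b p}"

abbreviation local_ring :: "('k::field ^ 3) set \<Rightarrow> 'k mpoly3 fract set" where
  "local_ring p \<equiv> stalk UNIV p"

text \<open>
  Let \<open>Z\<close> be the closed subscheme defined by a homogeneous ideal \<open>I\<close>. Its structure sheaf is the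
  quotient of the structure sheaf of the plane by the ideal sheaf of \<open>I\<close>, that is, the sheaf
  associated with the quotient presheaf. A global section is therefore a family of classes in
  \<open>local_ring p / stalk I p\<close>, one for each point \<open>p\<close>, which locally are the classes of one regular
  function \<open>t\<close>. A family of representatives \<open>s\<close> is a member of \<open>section_reps I\<close>; it represents the
  zero section if it is a member of \<open>zero_section_reps I\<close>. Hence the space of global sections is
  the quotient of \<open>section_reps I\<close> by \<open>zero_section_reps I\<close>. (Values of \<open>s\<close> outside of the
  plane are unconstrained in both spaces and disappear in the quotient.)
\<close>

definition section_reps :: "'k::field mpoly3 set \<Rightarrow> (('k ^ 3) set \<Rightarrow> 'k mpoly3 fract) set" where
  "section_reps I = {s. \<forall>p\<in>proj_plane. s p \<in> local_ring p \<and>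
     (\<exists>U t. zariski_open U \<and> p \<in> U \<and> (\<forall>q\<in>U. t \<in> local_ring q \<and> s q - t \<in> stalk I q))}"

definition zero_section_reps ::
    "'k::field mpoly3 set \<Rightarrow> (('k ^ 3) set \<Rightarrow> 'k mpoly3 fract) set" where
  "zero_section_reps I = {s. \<forall>p\<in>proj_plane. s p \<in> stalk I p}"

definition scale_section ::
    "'k::field \<Rightarrow> (('k ^ 3) set \<Rightarrow> 'k mpoly3 fract) \<Rightarrow> ('k ^ 3) set \<Rightarrow> 'k mpoly3 fract" where
  "scale_section c s = (\<lambda>p. Fract (Poly_Mapping.single 0 c) 1 * s p)"

text \<open>
  \<open>B\<close> is a set of representatives of a finite basis of the quotient space \<open>V / W\<close>: every element of
  \<open>V\<close> is a linear combination of \<open>B\<close> modulo \<open>W\<close>, with unique coefficients.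
\<close>

definition quotient_basis ::
    "('k::field \<Rightarrow> 'v::ab_group_add \<Rightarrow> 'v) \<Rightarrow> 'v set \<Rightarrow> 'v set \<Rightarrow> 'v set \<Rightarrow> bool" where
  "quotient_basis smul V W B \<longleftrightarrow> finite B \<and> B \<subseteq> V \<and>
     (\<forall>v\<in>V. \<exists>!c. (\<forall>b. b \<notin> B \<longrightarrow> c b = 0) \<and> v - (\<Sum>b\<in>B. smul (c b) b) \<in> W)"

text \<open>Only meaningful for subspaces \<open>W \<subseteq> V\<close> with \<open>V / W\<close> finite-dimensional.\<close>

definition quotient_dim ::
    "('k::field \<Rightarrow> 'v::ab_group_add \<Rightarrow> 'v) \<Rightarrow> 'v set \<Rightarrow> 'v set \<Rightarrow> nat" where
  "quotient_dim smul V W = (THE n. \<exists>B. quotient_basis smul V W B \<and> card B = n)"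

definition h0_structure_sheaf :: "'k::field mpoly3 set \<Rightarrow> nat" where
  "h0_structure_sheaf I = quotient_dim scale_section (section_reps I) (zero_section_reps I)"


section \<open>Plane curves\<close>

definition jacobian_ideal :: "'k::field mpoly3 \<Rightarrow> 'k mpoly3 set" where
  "jacobian_ideal f = {(\<Sum>i\<in>UNIV. a $ i * pdiff i f) | a :: 'k mpoly3 ^ 3. True}"

definition tjurina_number :: "'k::field mpoly3 \<Rightarrow> nat" where
  "tjurina_number f = h0_structure_sheaf (jacobian_ideal f)"

text \<open>
  The global sections of \<open>E\<^sub>C(m)\<close>: the kernel of the map on global sections of \<open>\<O>(m)\<^sup>3\<close> given by the
  partial derivatives, that is, the syzygies of degree \<open>m\<close> between them.
\<close>

definition syzygies :: "'k::field mpoly3 \<Rightarrow> int \<Rightarrow> ('k mpoly3 ^ 3) set" where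
  "syzygies f m = {a. (\<forall>i. homogeneous m (a $ i)) \<and> (\<Sum>i\<in>UNIV. a $ i * pdiff i f) = 0}"

definition min_syzygy_degree :: "'k::field mpoly3 \<Rightarrow> int" where
  "min_syzygy_degree f = (LEAST m. syzygies f m \<noteq> {0})"

text \<open>The homogeneous polynomial \<open>f\<close> is an equation of a reduced, singular plane curve of degree \<open>d\<close>.\<close>

definition reduced_singular_curve :: "nat \<Rightarrow> 'k::field mpoly3 \<Rightarrow> bool" where
  "reduced_singular_curve d f \<longleftrightarrow> f \<noteq> 0 \<and> homogeneous (int d) f \<and> squarefree f \<and>
     (\<exists>p\<in>proj_plane. vanishes_at f p \<and> (\<forall>i. vanishes_at (pdiff i f) p))"

end

theory Submission
  imports Defs "HOL-Analysis.Cartesian_Space"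
begin

text \<open>
  Both bounds are attained with \<open>r = 1\<close>, by curves all of whose singularities are concentrated at the
  single point \<open>(0 : 0 : 1)\<close>.

  The lower bound is then \<open>(d - 1) (d - 2)\<close>. It is attained by \<open>x\<^sup>d\<^sup>-\<^sup>1 z + y\<^sup>d\<close>, whose local algebra
  is \<open>k[x, y] / (x\<^sup>d\<^sup>-\<^sup>2, y\<^sup>d\<^sup>-\<^sup>1)\<close>. The upper bound is \<open>(d - 1) (d - 2) + 1\<close>. It is attained by
  \<open>x\<^sup>d\<^sup>-\<^sup>1 z + x y\<^sup>d\<^sup>-\<^sup>1\<close>, whose local algebra is \<open>k[x, y] / (x y\<^sup>d\<^sup>-\<^sup>2, (d - 1) x\<^sup>d\<^sup>-\<^sup>2 + y\<^sup>d\<^sup>-\<^sup>1)\<close>. In both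
  cases the polynomial has only two terms, so a torus acts on the curve; this yields a syzygy of degree one
  between the partial derivatives. These are linearly independent, hence there is no syzygy of degree
  zero (\<open>min_syzygy_degree_eq_1\<close>). The curves are reduced because a polynomial of degree one in \<open>z\<close> has a
  square factor only if its two coefficients share one (\<open>squarefree_binomial\<close>).

  The Tjurina number is computed in two steps. First, an ideal that contains powers of \<open>x\<close> and \<open>y\<close>
  has trivial stalks away from \<open>(0 : 0 : 1)\<close>, and the global sections of the structure sheaf of its scheme
  are the quotient of the local ring by the stalk at that point (\<open>h0_eq_card_local_basis\<close>). Secondly, a
  monomial basis of this quotient is certified by a rewriting of monomials for spanning, and for
  independence by a linear form that vanishes on the ideal and pairs the basis with a dual
  family of monomials (\<open>punctual_ideal_with_dual_basis.h0_eq_card\<close>). Denominators are removed because they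
  are invertible modulo the ideal up to powers of \<open>z\<close> (\<open>punctual_ideal.inverse_modulo\<close>).
\<close>

section \<open>Monomials and term-by-term maps\<close>

lemma prod_UNIV_3: "(\<Prod>i\<in>(UNIV::3 set). g i) = g 1 * g 2 * (g 3 :: 'a::comm_monoid_mult)"
  unfolding UNIV_3 by (simp add: mult.assoc del: One_nat_def)

definition expo :: "nat \<Rightarrow> nat \<Rightarrow> nat \<Rightarrow> 3 \<Rightarrow>\<^sub>0 nat" where
  "expo i j l = Poly_Mapping.single 1 i + Poly_Mapping.single 2 j + Poly_Mapping.single 3 l"

lemma lookup_expo [simp]:
  "Poly_Mapping.lookup (expo i j l) 1 = i"
  "Poly_Mapping.lookup (expo i j l) 2 = j"
  "Poly_Mapping.lookup (expo i j l) 3 = l"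
  by (simp_all add: expo_def lookup_add lookup_single)

lemma expo_eqI:
  assumes "Poly_Mapping.lookup m 1 = i" "Poly_Mapping.lookup m 2 = j" "Poly_Mapping.lookup m 3 = l"
  shows "m = expo i j l"
proof (rule poly_mapping_eqI)
  fix k :: 3
  show "Poly_Mapping.lookup m k = Poly_Mapping.lookup (expo i j l) k"
    using assms exhaust_3[of k] by auto
qed

lemma expo_lookups: "expo (Poly_Mapping.lookup m 1) (Poly_Mapping.lookup m 2) (Poly_Mapping.lookup m 3) = m"
  by (rule expo_eqI[symmetric]) auto

lemma expo_eq_iff [simp]: "expo i j l = expo i' j' l' \<longleftrightarrow> i = i' \<and> j = j' \<and> l = l'"
  by (metis lookup_expo)

lemma expo_add: "expo i j l + expo i' j' l' = expo (i + i') (j + j') (l + l')"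
  by (rule expo_eqI) (simp_all add: lookup_add)

definition mterm :: "'k::field \<Rightarrow> nat \<Rightarrow> nat \<Rightarrow> nat \<Rightarrow> 'k mpoly3" where
  "mterm c i j l = Poly_Mapping.single (expo i j l) c"

lemma mterm_mult: "mterm c i j l * mterm c' i' j' l' = mterm (c * c') (i + i') (j + j') (l + l')"
  by (simp add: mterm_def mult_single expo_add)

lemma mterm_add: "mterm c i j l + mterm c' i j l = mterm (c + c') i j l"
  by (simp add: mterm_def single_add)

lemma mterm_minus: "- mterm c i j l = mterm (- c) i j l"
  by (simp add: mterm_def single_uminus)

lemma mterm_0 [simp]: "mterm 0 i j l = 0"
  by (simp add: mterm_def)

lemma mterm_1: "mterm 1 0 0 0 = 1"
proof -
  have "expo 0 0 0 = 0" by (simp add: expo_def)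
  then show ?thesis by (simp add: mterm_def)
qed

lemma mterm_power: "mterm c i j l ^ n = mterm (c ^ n) (n * i) (n * j) (n * l)"
  by (induction n) (simp_all add: mterm_1 mterm_mult)

lemma single_eq_mterm:
  "Poly_Mapping.single m c =
    mterm c (Poly_Mapping.lookup m 1) (Poly_Mapping.lookup m 2) (Poly_Mapping.lookup m 3)"
  by (simp add: mterm_def expo_lookups)

lemma mterm_eq_0_iff [simp]: "mterm c i j l = 0 \<longleftrightarrow> c = 0"
  by (metis lookup_single_eq lookup_zero mterm_0 mterm_def)

lemma lookup_mterm:
  "Poly_Mapping.lookup (mterm c i j l) (expo i' j' l') = (if i = i' \<and> j = j' \<and> l = l' then c else 0)"
  by (simp add: mterm_def lookup_single when_def)

lemma poly_mapping_eq_sum_single: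
  "f = (\<Sum>m\<in>Poly_Mapping.keys f. Poly_Mapping.single m (Poly_Mapping.lookup f m))"
proof (rule poly_mapping_eqI)
  fix k
  have "(\<Sum>m\<in>Poly_Mapping.keys f. Poly_Mapping.lookup f m when m = k) =
      (\<Sum>m\<in>Poly_Mapping.keys f. if m = k then Poly_Mapping.lookup f m else 0)"
    by (simp add: when_def)
  also have "\<dots> = Poly_Mapping.lookup f k"
    by (simp add: in_keys_iff)
  finally show "Poly_Mapping.lookup f k = Poly_Mapping.lookup
      (\<Sum>m\<in>Poly_Mapping.keys f. Poly_Mapping.single m (Poly_Mapping.lookup f m)) k"
    by (simp add: lookup_sum lookup_single)
qed

text \<open>
  Additive properties need to be checked only on the terms of \<open>f\<close> itself. Restricting to these keeps
  the degree available in the induction when \<open>f\<close> is homogeneous.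
\<close>

lemma mpoly3_additive_induct [consumes 0, case_names zero add mterm]:
  assumes zero: "P 0" and add: "\<And>f g. P f \<Longrightarrow> P g \<Longrightarrow> P (f + g)"
    and mterm: "\<And>i j l. expo i j l \<in> Poly_Mapping.keys f \<Longrightarrow>
      P (mterm (Poly_Mapping.lookup f (expo i j l)) i j l)"
  shows "P f"
proof -
  have "P (\<Sum>m\<in>A. Poly_Mapping.single m (Poly_Mapping.lookup f m))"
    if "finite A" "A \<subseteq> Poly_Mapping.keys f" for A
    using that
  proof (induction A)
    case empty
    then show ?case using zero by simp
  next
    case (insert m A)
    then have "P (mterm (Poly_Mapping.lookup f m) (Poly_Mapping.lookup m 1)
        (Poly_Mapping.lookup m 2) (Poly_Mapping.lookup m 3))"
      using mterm[of "Poly_Mapping.lookup m 1" "Poly_Mapping.lookup m 2" "Poly_Mapping.lookup m 3"]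
      by (simp add: expo_lookups)
    then show ?case
      using insert add by (simp add: single_eq_mterm[of m])
  qed
  from this[of "Poly_Mapping.keys f"] show ?thesis
    by (simp flip: poly_mapping_eq_sum_single)
qed

text \<open>
  Evaluation, partial derivatives, the passage to polynomials in one chosen variable and the linear
  form used for Tjurina numbers are all given by a formula on terms, so that their additivity and
  multiplicativity are instances of \<open>termwise_add\<close> and \<open>termwise_mult\<close>.
\<close>

definition termwise :: "((3 \<Rightarrow>\<^sub>0 nat) \<Rightarrow> 'k::field \<Rightarrow> 'b::comm_monoid_add) \<Rightarrow> 'k mpoly3 \<Rightarrow> 'b" where
  "termwise \<phi> f = (\<Sum>m\<in>Poly_Mapping.keys f. \<phi> m (Poly_Mapping.lookup f m))"

locale termwise_additive =
  fixes \<phi> :: "(3 \<Rightarrow>\<^sub>0 nat) \<Rightarrow> 'k::field \<Rightarrow> 'b::comm_monoid_add"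
  assumes zero: "\<phi> m 0 = 0" and add: "\<phi> m (c + c') = \<phi> m c + \<phi> m c'"
begin

lemma termwise_0 [simp]: "termwise \<phi> 0 = 0"
  by (simp add: termwise_def)

lemma termwise_add: "termwise \<phi> (f + g) = termwise \<phi> f + termwise \<phi> g"
  unfolding termwise_def by (rule setsum_keys_plus_distrib) (simp_all add: zero add)

lemma termwise_single: "termwise \<phi> (Poly_Mapping.single m c) = \<phi> m c"
  by (simp add: termwise_def zero)

lemma termwise_mterm: "termwise \<phi> (mterm c i j l) = \<phi> (expo i j l) c"
  by (simp add: mterm_def termwise_single)

lemma termwise_sum: "termwise \<phi> (\<Sum>i\<in>A. g i) = (\<Sum>i\<in>A. termwise \<phi> (g i))"
  by (induction A rule: infinite_finite_induct) (simp_all add: termwise_add)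

end

lemma termwise_mult:
  fixes \<phi> :: "(3 \<Rightarrow>\<^sub>0 nat) \<Rightarrow> 'k::field \<Rightarrow> 'b::comm_semiring_0"
  assumes "termwise_additive \<phi>"
    and mult: "\<And>m m' c c'. \<phi> (m + m') (c * c') = \<phi> m c * \<phi> m' c'"
  shows "termwise \<phi> (f * g) = termwise \<phi> f * termwise \<phi> g"
proof -
  interpret termwise_additive \<phi> by fact
  have single: "termwise \<phi> (mterm a i j l * g) = termwise \<phi> (mterm a i j l) * termwise \<phi> g" for a i j l
  proof (induction g rule: mpoly3_additive_induct)
    case (mterm i' j' l')
    then show ?case
      by (simp add: mterm_def mult_single termwise_single mult)
  qed (simp_all add: distrib_left termwise_add)
  show ?thesis
  proof (induction f rule: mpoly3_additive_induct)
    case (mterm i j l)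
    show ?case by (rule single)
  qed (simp_all add: distrib_right termwise_add)
qed

lemma eval3_termwise:
  "eval3 f v = termwise (\<lambda>m c. c * (\<Prod>i\<in>UNIV. (v $ i) ^ Poly_Mapping.lookup m i)) f"
  by (simp add: eval3_def termwise_def)

lemma termwise_additive_eval3:
  "termwise_additive (\<lambda>m (c::'k::field). c * (\<Prod>i\<in>UNIV. (v $ i) ^ Poly_Mapping.lookup m i))"
  by unfold_locales (simp_all add: distrib_right)

lemma eval3_0 [simp]: "eval3 0 v = 0"
  by (simp add: eval3_def)

lemma eval3_add: "eval3 (f + g) v = eval3 f v + eval3 g v"
  unfolding eval3_termwise by (rule termwise_additive.termwise_add[OF termwise_additive_eval3])

lemma eval3_mult: "eval3 (f * g) v = eval3 f v * eval3 g v"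
  unfolding eval3_termwise
  by (rule termwise_mult[OF termwise_additive_eval3]) (simp add: lookup_add power_add prod.distrib)

lemma eval3_mterm: "eval3 (mterm c i j l) v = c * (v $ 1 ^ i * v $ 2 ^ j * v $ 3 ^ l)"
  unfolding eval3_termwise
  by (subst termwise_additive.termwise_mterm[OF termwise_additive_eval3]) (simp add: prod_UNIV_3)

lemma pdiff_termwise:
  "pdiff i f = termwise (\<lambda>m c. Poly_Mapping.single (m - Poly_Mapping.single i 1)
     (of_nat (Poly_Mapping.lookup m i) * c)) f"
  by (simp add: pdiff_def termwise_def)

lemma termwise_additive_pdiff:
  "termwise_additive (\<lambda>m (c::'k::field). Poly_Mapping.single (m - Poly_Mapping.single i 1)
     (of_nat (Poly_Mapping.lookup m i) * c))"
  by unfold_locales (simp_all add: distrib_left single_add)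

lemma pdiff_add: "pdiff i (f + g) = pdiff i f + pdiff i g"
  unfolding pdiff_termwise by (rule termwise_additive.termwise_add[OF termwise_additive_pdiff])

lemma expo_minus_single:
  "expo i j l - Poly_Mapping.single 1 1 = expo (i - 1) j l"
  "expo i j l - Poly_Mapping.single 2 1 = expo i (j - 1) l"
  "expo i j l - Poly_Mapping.single 3 1 = expo i j (l - 1)"
  by (rule expo_eqI; simp add: lookup_minus lookup_single)+

lemma pdiff_mterm:
  "pdiff 1 (mterm c i j l) = mterm (of_nat i * c) (i - 1) j l"
  "pdiff 2 (mterm c i j l) = mterm (of_nat j * c) i (j - 1) l"
  "pdiff 3 (mterm c i j l) = mterm (of_nat l * c) i j (l - 1)"
  unfolding pdiff_termwise termwise_additive.termwise_mterm[OF termwise_additive_pdiff]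
    expo_minus_single by (simp_all add: mterm_def)

section \<open>Homogeneous polynomials\<close>

lemma homogeneous_iff:
  "homogeneous n f \<longleftrightarrow> (\<forall>i j l. expo i j l \<in> Poly_Mapping.keys f \<longrightarrow> int (i + j + l) = n)"
proof -
  have "homogeneous n f \<longleftrightarrow> (\<forall>m\<in>Poly_Mapping.keys f.
      int (Poly_Mapping.lookup m 1 + Poly_Mapping.lookup m 2 + Poly_Mapping.lookup m 3) = n)"
    unfolding homogeneous_def by (simp add: sum_3)
  then show ?thesis
    by (metis expo_lookups lookup_expo)
qed

lemma homogeneous_0 [simp]: "homogeneous n 0"
  by (simp add: homogeneous_def)

lemma homogeneous_add: "homogeneous n f \<Longrightarrow> homogeneous n g \<Longrightarrow> homogeneous n (f + g)"
  using keys_add[of f g] unfolding homogeneous_def by blast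

lemma homogeneous_minus: "homogeneous n f \<Longrightarrow> homogeneous n (- f)"
  by (simp add: homogeneous_def in_keys_iff)

lemma homogeneous_diff: "homogeneous n f \<Longrightarrow> homogeneous n g \<Longrightarrow> homogeneous n (f - g)"
  using homogeneous_add[of n f "- g"] homogeneous_minus[of n g] by simp

lemma homogeneous_mterm: "n = int (i + j + l) \<Longrightarrow> homogeneous n (mterm c i j l)"
  by (auto simp: homogeneous_iff mterm_def split: if_splits)

lemma homogeneous_mult:
  assumes "homogeneous a f" "homogeneous b g"
  shows "homogeneous (a + b) (f * g)"
proof -
  have "\<exists>m\<in>Poly_Mapping.keys f. \<exists>m'\<in>Poly_Mapping.keys g. k = m + m'"
    if "k \<in> Poly_Mapping.keys (f * g)" for k
    using subsetD[OF keys_mult that] by blast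
  then show ?thesis
    using assms unfolding homogeneous_def by (force simp: lookup_add sum.distrib)
qed

lemma homogeneous_1: "homogeneous 0 1"
  using homogeneous_mterm[of 0 0 0 0 1] by (simp add: mterm_1)

lemma homogeneous_power: "homogeneous a f \<Longrightarrow> homogeneous (int n * a) (f ^ n)"
  by (induction n) (auto simp: homogeneous_1 distrib_right intro: homogeneous_mult)

lemma homogeneous_sum: "(\<And>i. i \<in> A \<Longrightarrow> homogeneous n (g i)) \<Longrightarrow> homogeneous n (\<Sum>i\<in>A. g i)"
  by (induction A rule: infinite_finite_induct) (auto intro: homogeneous_add)

lemma homogeneous_neg: "homogeneous n f \<Longrightarrow> n < 0 \<Longrightarrow> f = 0"
  unfolding homogeneous_def by (metis keys_eq_empty ex_in_conv of_nat_0_le_iff not_le)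

lemma homogeneous_int_cases:
  assumes "homogeneous n f" "f \<noteq> 0"
  obtains n' where "n = int n'"
  using assms homogeneous_neg by (metis nonneg_int_cases not_le)

lemma homogeneous_degree_0:
  assumes "homogeneous 0 f"
  shows "f = mterm (Poly_Mapping.lookup f 0) 0 0 0"
proof (rule poly_mapping_eqI)
  fix m
  have "expo 0 0 0 = 0" by (simp add: expo_def)
  then show "Poly_Mapping.lookup f m = Poly_Mapping.lookup (mterm (Poly_Mapping.lookup f 0) 0 0 0) m"
    using assms expo_lookups[of m] unfolding homogeneous_iff mterm_def
    by (metis (no_types, lifting) add_eq_0_iff_both_eq_0 in_keys_iff lookup_single_eq
        lookup_single_not_eq of_nat_eq_0_iff)
qed

lemma eval3_homogeneous_scale:
  assumes "homogeneous n f"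
  shows "eval3 f (c *s v) = c ^ nat n * eval3 f v"
proof (induction f rule: mpoly3_additive_induct)
  case (mterm i j l)
  then have "nat n = i + j + l" using assms unfolding homogeneous_iff by force
  then show ?case
    by (simp add: eval3_mterm power_add power_mult_distrib)
qed (simp_all add: eval3_add distrib_left)

section \<open>Degree in one variable and squarefree binomials\<close>

text \<open>
  The coefficients keep the variable \<open>i\<close>: no type of polynomials in the other two
  variables is needed, the map is still multiplicative and injective, and the degree of
  the image is the degree in the variable \<open>i\<close>.
\<close>

definition poly_in :: "3 \<Rightarrow> 'k::field mpoly3 \<Rightarrow> 'k mpoly3 poly" where
  "poly_in i = termwise (\<lambda>m c. monom (Poly_Mapping.single m c) (Poly_Mapping.lookup m i))"

lemma termwise_additive_poly_in:
  "termwise_additive (\<lambda>m (c::'k::field). monom (Poly_Mapping.single m c) (Poly_Mapping.lookup m i))"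
  by unfold_locales (simp_all add: single_add add_monom)

lemma poly_in_0 [simp]: "poly_in i 0 = 0"
  by (simp add: poly_in_def termwise_def)

lemma poly_in_add: "poly_in i (f + g) = poly_in i f + poly_in i g"
  unfolding poly_in_def by (rule termwise_additive.termwise_add[OF termwise_additive_poly_in])

lemma poly_in_mult: "poly_in i (f * g) = poly_in i f * poly_in i g"
  unfolding poly_in_def
  by (rule termwise_mult[OF termwise_additive_poly_in]) (simp add: lookup_add mult_monom mult_single)

lemma poly_in_mterm:
  "poly_in v (mterm c i j l) = monom (mterm c i j l) (Poly_Mapping.lookup (expo i j l) v)"
  unfolding poly_in_def termwise_additive.termwise_mterm[OF termwise_additive_poly_in]
  by (simp add: mterm_def)

lemma lookup_coeff_poly_in:
  "Poly_Mapping.lookup (coeff (poly_in v f) n) m =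
    (if Poly_Mapping.lookup m v = n then Poly_Mapping.lookup f m else 0)"
proof (induction f rule: mpoly3_additive_induct)
  case (mterm i j l)
  show ?case
    unfolding poly_in_mterm by (auto simp: mterm_def lookup_single when_def)
qed (simp_all add: poly_in_add lookup_add)

lemma poly_in_eq_0_iff [simp]: "poly_in v f = 0 \<longleftrightarrow> f = 0"
proof
  assume "poly_in v f = 0"
  then have "Poly_Mapping.lookup f m = 0" for m
    using lookup_coeff_poly_in[of v f "Poly_Mapping.lookup m v" m] by simp
  then show "f = 0" by (simp add: poly_mapping_eqI)
qed simp

lemma degree_poly_in_square_mult:
  assumes "g\<^sup>2 * h = f" "f \<noteq> 0"
  shows "2 * degree (poly_in v g) + degree (poly_in v h) = degree (poly_in v f)"
proof -
  have "g \<noteq> 0" "h \<noteq> 0" using assms by auto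
  then show ?thesis
    unfolding assms(1)[symmetric] by (simp add: poly_in_mult power2_eq_square degree_mult_eq)
qed

lemma lookup_eq_0_if_degree_poly_in_eq_0:
  assumes "degree (poly_in v g) = 0" "m \<in> Poly_Mapping.keys g"
  shows "Poly_Mapping.lookup m v = 0"
proof (rule ccontr)
  assume "Poly_Mapping.lookup m v \<noteq> 0"
  then have "coeff (poly_in v g) (Poly_Mapping.lookup m v) = 0"
    using assms(1) by (simp add: coeff_eq_0)
  then show False
    using lookup_coeff_poly_in[of v g "Poly_Mapping.lookup m v" m] assms(2) by (simp add: in_keys_iff)
qed

lemma is_unit_if_degrees_eq_0:
  fixes g :: "'k::field mpoly3"
  assumes "g \<noteq> 0" "\<And>v. degree (poly_in v g) = 0"
  shows "g dvd 1"
proof -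
  have "homogeneous 0 g"
    unfolding homogeneous_def using lookup_eq_0_if_degree_poly_in_eq_0[OF assms(2)] by simp
  then obtain c where c: "g = mterm c 0 0 0" by (metis homogeneous_degree_0)
  then have "c \<noteq> 0" using assms(1) by auto
  then have "g * mterm (inverse c) 0 0 0 = 1"
    unfolding c by (simp add: mterm_mult mterm_1)
  then show ?thesis by (metis dvdI)
qed

text \<open>
  The polynomial has degree one in \<open>z\<close>, so a square factor \<open>g\<^sup>2\<close> is free of \<open>z\<close> and divides both
  coefficients \<open>x\<^sup>a z\<close> and \<open>x\<^sup>e y\<^sup>b\<close>. The first shows that \<open>g\<close> is free of \<open>y\<close>; the second, together with
  \<open>e \<le> 1\<close>, that it is free of \<open>x\<close>.
\<close>

lemma squarefree_binomial:
  assumes "e \<le> 1"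
  shows "squarefree (mterm 1 a 0 1 + mterm 1 e b 0 :: 'k::field mpoly3)"
proof (rule squarefreeI)
  fix g :: "'k mpoly3"
  let ?f = "mterm 1 a 0 1 + mterm 1 e b 0 :: 'k mpoly3"
  assume "g\<^sup>2 dvd ?f"
  then obtain h where h: "g\<^sup>2 * h = ?f" by (metis dvdE)
  have in_z: "poly_in 3 ?f = monom (mterm 1 a 0 1) 1 + monom (mterm 1 e b 0) 0"
    by (simp add: poly_in_add poly_in_mterm)
  have c1: "coeff (poly_in 3 ?f) 1 = mterm 1 a 0 1" and c0: "coeff (poly_in 3 ?f) 0 = mterm 1 e b 0"
    unfolding in_z by simp_all
  have f0: "?f \<noteq> 0" using c1 by (metis coeff_0 mterm_eq_0_iff one_neq_zero poly_in_0)
  then have g0: "g \<noteq> 0" using h by auto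
  have "degree (poly_in 3 ?f) \<le> 1"
    unfolding in_z by (intro degree_add_le order.trans[OF degree_monom_le]) auto
  then have z: "degree (poly_in 3 g) = 0"
    using degree_poly_in_square_mult[OF h f0, of 3] by simp
  have "coeff (poly_in 3 g) 0 = g"
    by (rule poly_mapping_eqI)
      (metis lookup_coeff_poly_in lookup_eq_0_if_degree_poly_in_eq_0[OF z] in_keys_iff)
  then have "poly_in 3 g = [:g:]"
    by (metis z degree_0_id)
  then have in_z_f: "poly_in 3 ?f = smult (g\<^sup>2) (poly_in 3 h)"
    unfolding h[symmetric] by (simp add: poly_in_mult power2_eq_square)
  have h1: "g\<^sup>2 * coeff (poly_in 3 h) 1 = mterm 1 a 0 1"
    using c1 unfolding in_z_f by simp
  have h0: "g\<^sup>2 * coeff (poly_in 3 h) 0 = mterm 1 e b 0"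
    using c0 unfolding in_z_f by simp
  have y: "degree (poly_in 2 g) = 0"
    using degree_poly_in_square_mult[OF h1, of 2] by (simp add: poly_in_mterm degree_monom_eq)
  have x: "degree (poly_in 1 g) = 0"
    using degree_poly_in_square_mult[OF h0, of 1] assms by (simp add: poly_in_mterm degree_monom_eq)
  show "g dvd 1"
  proof (rule is_unit_if_degrees_eq_0[OF g0])
    show "degree (poly_in v g) = 0" for v
      using x y z exhaust_3[of v] by auto
  qed
qed

section \<open>The dimension of a quotient space\<close>

lemma sum_fun_apply: "(\<Sum>i\<in>A. g i) x = (\<Sum>i\<in>A. g i x)"
  by (induction A rule: infinite_finite_induct) simp_all

text \<open>
  If \<open>P\<close> and \<open>Q\<close> are the base change matrices, then \<open>P Q = 1\<close> and \<open>Q P = 1\<close>, since coordinates are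
  unique. The traces of \<open>P Q\<close> and \<open>Q P\<close> agree, and in characteristic zero the trace of an identity
  matrix determines its size.
\<close>

lemma card_quotient_basis_unique:
  fixes smul :: "'k::field_char_0 \<Rightarrow> 'v::ab_group_add \<Rightarrow> 'v"
  assumes "vector_space smul" and W: "module.subspace smul W"
    and B: "quotient_basis smul V W B" and B': "quotient_basis smul V W B'"
  shows "card B = card B'"
proof -
  interpret vector_space smul by fact
  have coordinates: "\<exists>P. \<forall>b\<in>B. b - (\<Sum>b'\<in>B'. smul (P b b') b') \<in> W"
    if "quotient_basis smul V W B" "quotient_basis smul V W B'" for B B'
    using that unfolding quotient_basis_def by (intro bchoice ballI) blast
  obtain P where P: "\<And>b. b \<in> B \<Longrightarrow> b - (\<Sum>b'\<in>B'. smul (P b b') b') \<in> W"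
    using coordinates[OF B B'] by blast
  obtain Q where Q: "\<And>b'. b' \<in> B' \<Longrightarrow> b' - (\<Sum>b\<in>B. smul (Q b' b) b) \<in> W"
    using coordinates[OF B' B] by blast
  have inverse: "(\<Sum>b'\<in>B'. P b b' * Q b' b) = 1"
    if B: "quotient_basis smul V W B" and B': "quotient_basis smul V W B'" and b: "b \<in> B"
      and P: "\<And>b. b \<in> B \<Longrightarrow> b - (\<Sum>b'\<in>B'. smul (P b b') b') \<in> W"
      and Q: "\<And>b'. b' \<in> B' \<Longrightarrow> b' - (\<Sum>b\<in>B. smul (Q b' b) b) \<in> W" for B B' P Q b
  proof -
    have fin: "finite B" "finite B'" and "b \<in> V"
      using B B' b by (auto simp: quotient_basis_def)
    define c where "c = (\<lambda>a. if a \<in> B then \<Sum>b'\<in>B'. P b b' * Q b' a else 0)"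
    define e where "e = (\<lambda>a. if a = b then 1 else 0 :: 'k)"
    have "(\<Sum>b'\<in>B'. smul (P b b') (b' - (\<Sum>a\<in>B. smul (Q b' a) a))) \<in> W"
      by (intro subspace_sum[OF W] subspace_scale[OF W] Q)
    then have "(b - (\<Sum>b'\<in>B'. smul (P b b') b')) +
        (\<Sum>b'\<in>B'. smul (P b b') (b' - (\<Sum>a\<in>B. smul (Q b' a) a))) \<in> W"
      by (intro subspace_add[OF W] P b)
    also have "(b - (\<Sum>b'\<in>B'. smul (P b b') b')) +
        (\<Sum>b'\<in>B'. smul (P b b') (b' - (\<Sum>a\<in>B. smul (Q b' a) a))) =
        b - (\<Sum>b'\<in>B'. \<Sum>a\<in>B. smul (P b b' * Q b' a) a)"
      by (simp add: scale_right_diff_distrib sum_subtractf scale_sum_right)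
    also have "(\<Sum>b'\<in>B'. \<Sum>a\<in>B. smul (P b b' * Q b' a) a) = (\<Sum>a\<in>B. smul (c a) a)"
      by (subst sum.swap) (simp add: c_def scale_sum_left)
    finally have c: "b - (\<Sum>a\<in>B. smul (c a) a) \<in> W" .
    have "(\<Sum>a\<in>B. smul (e a) a) = (\<Sum>a\<in>B. if a = b then a else 0)"
      by (rule sum.cong) (simp_all add: e_def)
    then have e: "b - (\<Sum>a\<in>B. smul (e a) a) \<in> W"
      using b fin subspace_0[OF W] by simp
    have "\<exists>!a. (\<forall>b. b \<notin> B \<longrightarrow> a b = 0) \<and> b - (\<Sum>a'\<in>B. smul (a a') a') \<in> W"
      using B \<open>b \<in> V\<close> unfolding quotient_basis_def by blast
    then obtain a\<^sub>0 where unique: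
      "\<And>a. (\<forall>b. b \<notin> B \<longrightarrow> a b = 0) \<and> b - (\<Sum>a'\<in>B. smul (a a') a') \<in> W \<Longrightarrow> a = a\<^sub>0"
      unfolding Ex1_def by blast
    have "c = a\<^sub>0" by (rule unique) (use c in \<open>simp add: c_def\<close>)
    also have "\<dots> = e" by (rule unique[symmetric]) (use e b in \<open>auto simp: e_def\<close>)
    finally have "c b = e b" by simp
    then show ?thesis using b by (simp add: c_def e_def)
  qed
  have "of_nat (card B) = (\<Sum>b\<in>B. \<Sum>b'\<in>B'. P b b' * Q b' b)"
    using inverse[OF B B' _ P Q] by simp
  also have "\<dots> = (\<Sum>b'\<in>B'. \<Sum>b\<in>B. Q b' b * P b b')"
    by (subst sum.swap) (simp add: mult.commute)
  also have "\<dots> = of_nat (card B')"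
    using inverse[OF B' B _ Q P] by simp
  finally show ?thesis by (simp only: of_nat_eq_iff)
qed

text \<open>
  Bases are given here as indexed families, because distinct indices are what one can count
  directly; injectivity of the family is part of its independence.
\<close>

lemma quotient_dim_eq_card:
  fixes smul :: "'k::field_char_0 \<Rightarrow> 'v::ab_group_add \<Rightarrow> 'v"
  assumes "vector_space smul" and W: "module.subspace smul W" and fin: "finite B"
    and e: "\<And>i. i \<in> B \<Longrightarrow> e i \<in> V"
    and span: "\<And>v. v \<in> V \<Longrightarrow> \<exists>c. v - (\<Sum>i\<in>B. smul (c i) (e i)) \<in> W"
    and indep: "\<And>c i. (\<Sum>i\<in>B. smul (c i) (e i)) \<in> W \<Longrightarrow> i \<in> B \<Longrightarrow> c i = 0"
  shows "quotient_dim smul V W = card B"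
proof -
  interpret vector_space smul by fact
  have inj: "inj_on e B"
  proof (rule inj_onI, rule ccontr)
    fix i j assume ij: "i \<in> B" "j \<in> B" "e i = e j" "i \<noteq> j"
    define c where "c = (\<lambda>k. (if k = i then 1 else 0) - (if k = j then 1 else 0) :: 'k)"
    have "(\<Sum>k\<in>B. smul (c k) (e k)) =
        (\<Sum>k\<in>B. if k = i then e k else 0) - (\<Sum>k\<in>B. if k = j then e k else 0)"
      unfolding sum_subtractf[symmetric] by (rule sum.cong) (auto simp: c_def)
    also have "\<dots> = 0" using ij fin by simp
    finally have "c i = 0" using indep[of c i] ij subspace_0[OF W] by simp
    then show False using ij by (simp add: c_def)
  qed
  have reindex: "(\<Sum>b\<in>e ` B. smul (c b) b) = (\<Sum>i\<in>B. smul (c (e i)) (e i))" for c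
    by (rule sum.reindex_cong[OF inj]) auto
  have basis: "quotient_basis smul V W (e ` B)"
    unfolding quotient_basis_def
  proof (intro conjI ballI)
    fix v assume "v \<in> V"
    then obtain c where c: "v - (\<Sum>i\<in>B. smul (c i) (e i)) \<in> W" using span by blast
    define c' where "c' = (\<lambda>b. if b \<in> e ` B then c (the_inv_into B e b) else 0)"
    have "(\<Sum>i\<in>B. smul (c i) (e i)) = (\<Sum>b\<in>e ` B. smul (c' b) b)"
      unfolding reindex by (rule sum.cong) (simp_all add: c'_def the_inv_into_f_f[OF inj])
    then have c': "v - (\<Sum>b\<in>e ` B. smul (c' b) b) \<in> W" using c by simp
    show "\<exists>!c. (\<forall>b. b \<notin> e ` B \<longrightarrow> c b = 0) \<and> v - (\<Sum>b\<in>e ` B. smul (c b) b) \<in> W"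
    proof (rule ex1I[of _ c'])
      fix a assume a: "(\<forall>b. b \<notin> e ` B \<longrightarrow> a b = 0) \<and> v - (\<Sum>b\<in>e ` B. smul (a b) b) \<in> W"
      have "(v - (\<Sum>b\<in>e ` B. smul (c' b) b)) - (v - (\<Sum>b\<in>e ` B. smul (a b) b)) \<in> W"
        by (rule subspace_diff[OF W c' conjunct2[OF a]])
      also have "(v - (\<Sum>b\<in>e ` B. smul (c' b) b)) - (v - (\<Sum>b\<in>e ` B. smul (a b) b)) =
          (\<Sum>i\<in>B. smul (a (e i) - c' (e i)) (e i))"
        unfolding reindex by (simp add: scale_left_diff_distrib sum_subtractf)
      finally have "(\<Sum>i\<in>B. smul (a (e i) - c' (e i)) (e i)) \<in> W" .
      then have eq: "a (e i) = c' (e i)" if "i \<in> B" for i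
        using indep[of "\<lambda>i. a (e i) - c' (e i)" i] that by simp
      show "a = c'"
      proof
        fix b
        show "a b = c' b" using a eq by (cases "b \<in> e ` B") (auto simp: c'_def)
      qed
    qed (use c' in \<open>simp add: c'_def\<close>)
  qed (use fin e in auto)
  have "card (e ` B) = card B" using inj by (rule card_image)
  show ?thesis
    unfolding quotient_dim_def
  proof (rule the_equality)
    show "\<exists>B'. quotient_basis smul V W B' \<and> card B' = card B"
      using basis \<open>card (e ` B) = card B\<close> by blast
    show "n = card B" if "\<exists>B'. quotient_basis smul V W B' \<and> card B' = n" for n
      using that card_quotient_basis_unique[OF assms(1) W _ basis] \<open>card (e ` B) = card B\<close> by auto
  qed
qed

section \<open>Points of the projective plane\<close>

text \<open>
  The point \<open>(0 : 0 : 1)\<close>, the origin of the affine chart \<open>z = 1\<close>.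
\<close>

definition origin :: "('k::field ^ 3) set" where
  "origin = {v. v $ 1 = 0 \<and> v $ 2 = 0 \<and> v $ 3 \<noteq> 0}"

lemma origin_eq_multiples: "origin = {c *s axis 3 1 | c. c \<noteq> (0::'k::field)}"
proof (rule set_eqI)
  fix v :: "'k ^ 3"
  have "v \<in> origin \<Longrightarrow> v = (v $ 3) *s axis 3 1"
    using exhaust_3 by (auto simp: origin_def vec_eq_iff axis_def forall_3)
  then show "v \<in> origin \<longleftrightarrow> v \<in> {c *s axis 3 1 | c. c \<noteq> 0}"
    by (auto simp: origin_def axis_def)
qed

lemma origin_in_proj_plane: "origin \<in> proj_plane"
proof -
  have "axis 3 1 \<noteq> (0 :: 'k::field ^ 3)" by (simp add: axis_eq_0_iff)
  then show ?thesis unfolding proj_plane_def origin_eq_multiples by blast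
qed

lemma vanishes_at_iff:
  assumes "homogeneous n f" "p = {c *s v | c. c \<noteq> 0}"
  shows "vanishes_at f p \<longleftrightarrow> eval3 f v = 0"
proof
  have "1 *s v \<in> p" unfolding assms(2) by (intro CollectI exI[of _ 1]) simp
  then show "vanishes_at f p \<Longrightarrow> eval3 f v = 0" unfolding vanishes_at_def by force
  show "eval3 f v = 0 \<Longrightarrow> vanishes_at f p"
    unfolding vanishes_at_def assms(2) using eval3_homogeneous_scale[OF assms(1)] by auto
qed

lemma vanishes_at_mult_iff:
  assumes "p \<in> proj_plane" "homogeneous m f" "homogeneous n g"
  shows "vanishes_at (f * g) p \<longleftrightarrow> vanishes_at f p \<or> vanishes_at g p"
proof -
  obtain v where v: "p = {c *s v | c. c \<noteq> 0}"
    using assms(1) unfolding proj_plane_def by blast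
  show ?thesis
    unfolding vanishes_at_iff[OF assms(2) v] vanishes_at_iff[OF assms(3) v]
      vanishes_at_iff[OF homogeneous_mult[OF assms(2,3)] v] by (simp add: eval3_mult)
qed

lemma vanishes_at_0 [simp]: "vanishes_at 0 p"
  by (simp add: vanishes_at_def)

lemma not_vanishes_at_1:
  assumes "p \<in> proj_plane"
  shows "\<not> vanishes_at 1 p"
proof -
  obtain v where v: "p = {c *s v | c. c \<noteq> 0}"
    using assms unfolding proj_plane_def by blast
  show ?thesis
    unfolding vanishes_at_iff[OF homogeneous_1 v] using eval3_mterm[of 1 0 0 0 v] by (simp add: mterm_1)
qed

lemma other_point_cases:
  fixes p :: "('k::field ^ 3) set"
  assumes "p \<in> proj_plane" "p \<noteq> origin"
  obtains "\<not> vanishes_at (mterm 1 1 0 0) p" | "\<not> vanishes_at (mterm 1 0 1 0) p"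
proof -
  obtain v where v: "p = {c *s v | c. c \<noteq> 0}" "v \<noteq> 0"
    using assms(1) unfolding proj_plane_def by blast
  have "v $ 1 \<noteq> 0 \<or> v $ 2 \<noteq> 0"
  proof (rule ccontr)
    assume *: "\<not> (v $ 1 \<noteq> 0 \<or> v $ 2 \<noteq> 0)"
    then have "v $ 3 \<noteq> 0" using v(2) by (auto simp: vec_eq_iff forall_3)
    have multiple: "c *s v = (c * v $ 3) *s axis 3 1" for c
      using * by (auto simp: vec_eq_iff axis_def forall_3)
    have "p = origin"
      unfolding v(1) origin_eq_multiples
    proof (intro subset_antisym subsetI; clarify)
      fix c :: 'k assume "c \<noteq> 0"
      show "\<exists>c'. c *s v = c' *s axis 3 1 \<and> c' \<noteq> 0"
        using \<open>c \<noteq> 0\<close> \<open>v $ 3 \<noteq> 0\<close> by (intro exI[of _ "c * v $ 3"]) (simp add: multiple)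
      show "\<exists>c'. c *s axis 3 1 = c' *s v \<and> c' \<noteq> 0"
        using \<open>c \<noteq> 0\<close> \<open>v $ 3 \<noteq> 0\<close> by (intro exI[of _ "c / v $ 3"]) (simp add: multiple)
    qed
    then show False using assms(2) by blast
  qed
  moreover have "homogeneous 1 (mterm 1 1 0 0 :: 'k mpoly3)" "homogeneous 1 (mterm 1 0 1 0 :: 'k mpoly3)"
    by (simp_all add: homogeneous_mterm)
  ultimately show thesis
    using that by (auto simp: vanishes_at_iff[OF _ v(1)] eval3_mterm)
qed

lemma vanishes_at_origin_mterm_iff:
  "vanishes_at (mterm c i j l) origin \<longleftrightarrow> c = 0 \<or> i \<noteq> 0 \<or> j \<noteq> 0"
  using vanishes_at_iff[OF homogeneous_mterm[OF refl] origin_eq_multiples, of c i j l]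
  by (auto simp: eval3_mterm axis_def)

text \<open>
  In a fixed degree \<open>n\<close>, the only monomial that does not vanish at the point \<open>(0 : 0 : 1)\<close> is \<open>z\<^sup>n\<close>.
\<close>

lemma eval3_axis_3:
  assumes "homogeneous (int n) f"
  shows "eval3 f (axis 3 1) = Poly_Mapping.lookup f (expo 0 0 n)"
proof (induction f rule: mpoly3_additive_induct)
  case (mterm i j l)
  then have "i + j + l = n" using assms unfolding homogeneous_iff by force
  then show ?case
    by (auto simp: eval3_mterm lookup_mterm axis_def power_0_left)
qed (simp_all add: eval3_add lookup_add)

section \<open>Schemes supported at one point\<close>

lemma stalkI:
  "a \<in> I \<Longrightarrow> homogeneous n a \<Longrightarrow> homogeneous n b \<Longrightarrow> \<not> vanishes_at b p \<Longrightarrow> Fract a b \<in> stalk I p"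
  unfolding stalk_def by blast

lemma stalkE:
  assumes "r \<in> stalk I p"
  obtains a b n where "r = Fract a b" "a \<in> I" "homogeneous (int n) a" "homogeneous (int n) b"
    "\<not> vanishes_at b p" "b \<noteq> 0"
proof -
  obtain a b n where r: "r = Fract a b" "a \<in> I" "homogeneous n a" "homogeneous n b" "\<not> vanishes_at b p"
    using assms unfolding stalk_def by blast
  then have "b \<noteq> 0" by auto
  obtain n' where "n = int n'"
    using r(4) \<open>b \<noteq> 0\<close> by (rule homogeneous_int_cases)
  then show thesis using that r \<open>b \<noteq> 0\<close> by blast
qed

text \<open>
  The scalars of \<open>scale_section\<close> as elements of the function field.
\<close>

definition const_fract :: "'k::field \<Rightarrow> 'k mpoly3 fract" where
  "const_fract c = Fract (mterm c 0 0 0) 1"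

lemma scale_section_apply: "scale_section c s p = const_fract c * s p"
proof -
  have "expo 0 0 0 = 0" by (simp add: expo_def)
  then show ?thesis by (simp add: scale_section_def const_fract_def mterm_def)
qed

lemma const_fract_hom:
  "const_fract (a + b) = const_fract a + const_fract b"
  "const_fract (a * b) = const_fract a * const_fract b"
  "const_fract 1 = 1"
  by (simp_all add: const_fract_def mterm_add mterm_mult mterm_1 One_fract_def)

lemma vector_space_scale_section: "vector_space scale_section"
  by unfold_locales
    (simp_all add: fun_eq_iff scale_section_apply const_fract_hom distrib_left distrib_right mult.assoc)

text \<open>
  An ideal containing powers of \<open>x\<close> and \<open>y\<close> defines a scheme supported at the point \<open>(0 : 0 : 1)\<close>.
\<close>

locale punctual_ideal =
  fixes I :: "'k::field_char_0 mpoly3 set" and N :: nat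
  assumes zero_mem: "0 \<in> I" and add_mem: "a \<in> I \<Longrightarrow> b \<in> I \<Longrightarrow> a + b \<in> I"
    and mult_mem: "a \<in> I \<Longrightarrow> g * a \<in> I"
    and x_power: "mterm 1 N 0 0 \<in> I" and y_power: "mterm 1 0 N 0 \<in> I"
begin

lemma diff_mem: "a \<in> I \<Longrightarrow> b \<in> I \<Longrightarrow> a - b \<in> I"
  using add_mem[of a "- b"] mult_mem[of b "- 1"] by simp

lemma stalk_0: "p \<in> proj_plane \<Longrightarrow> 0 \<in> stalk I p"
  unfolding Zero_fract_def using stalkI[OF zero_mem homogeneous_0 homogeneous_1 not_vanishes_at_1] .

lemma stalk_add:
  assumes p: "p \<in> proj_plane" and "r \<in> stalk I p" "s \<in> stalk I p"
  shows "r + s \<in> stalk I p"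
proof -
  obtain a b n where r: "r = Fract a b" "a \<in> I" "homogeneous (int n) a" "homogeneous (int n) b"
      "\<not> vanishes_at b p" "b \<noteq> 0" using assms(2) by (rule stalkE)
  obtain c d m where s: "s = Fract c d" "c \<in> I" "homogeneous (int m) c" "homogeneous (int m) d"
      "\<not> vanishes_at d p" "d \<noteq> 0" using assms(3) by (rule stalkE)
  have eq: "r + s = Fract (d * a + b * c) (b * d)"
    using r s by (simp add: mult.commute)
  have "homogeneous (int n + int m) (d * a + b * c)"
    using homogeneous_mult[OF s(4) r(3)] homogeneous_mult[OF r(4) s(3)]
    by (auto intro: homogeneous_add simp: add.commute)
  then show ?thesis
    unfolding eq using r s vanishes_at_mult_iff[OF p r(4) s(4)]
    by (intro stalkI[of _ _ "int n + int m"] add_mem mult_mem homogeneous_mult) auto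
qed

lemma stalk_mult:
  assumes p: "p \<in> proj_plane" and "r \<in> local_ring p" "s \<in> stalk I p"
  shows "r * s \<in> stalk I p"
proof -
  obtain a b n where r: "r = Fract a b" "homogeneous (int n) a" "homogeneous (int n) b"
      "\<not> vanishes_at b p" using assms(2) by (rule stalkE)
  obtain c d m where s: "s = Fract c d" "c \<in> I" "homogeneous (int m) c" "homogeneous (int m) d"
      "\<not> vanishes_at d p" using assms(3) by (rule stalkE)
  show ?thesis
    unfolding r(1) s(1) mult_fract using r s vanishes_at_mult_iff[OF p r(3) s(4)]
    by (intro stalkI[of _ _ "int n + int m"] mult_mem homogeneous_mult) auto
qed

lemma const_fract_in_local_ring: "p \<in> proj_plane \<Longrightarrow> const_fract c \<in> local_ring p"
  unfolding const_fract_def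
  by (rule stalkI[of _ _ 0]) (simp_all add: homogeneous_mterm homogeneous_1 not_vanishes_at_1)

text \<open>
  At every other point \<open>x\<close> or \<open>y\<close> is invertible, hence the ideal contains a local unit.
\<close>

lemma stalk_eq_local_ring:
  assumes p: "p \<in> proj_plane" "p \<noteq> origin"
  shows "stalk I p = local_ring p"
proof
  show "stalk I p \<subseteq> local_ring p" unfolding stalk_def by blast
  obtain g where g: "g \<in> I" "homogeneous (int N) g" "\<not> vanishes_at g p"
  proof -
    obtain v where v: "p = {c *s v | c. c \<noteq> 0}"
      using p(1) unfolding proj_plane_def by blast
    have *: "vanishes_at (mterm 1 i j 0) p \<longleftrightarrow> v $ 1 ^ i * v $ 2 ^ j = 0" for i j
      using vanishes_at_iff[OF homogeneous_mterm[OF refl] v] by (simp add: eval3_mterm)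
    show thesis
      by (rule other_point_cases[OF p])
        (use that[OF x_power] that[OF y_power] in \<open>auto simp: * homogeneous_mterm\<close>)
  qed
  show "local_ring p \<subseteq> stalk I p"
  proof
    fix r assume "r \<in> local_ring p"
    then obtain a b n where r: "r = Fract a b" "homogeneous (int n) a" "homogeneous (int n) b"
      "\<not> vanishes_at b p" by (rule stalkE)
    have "g \<noteq> 0" using g by auto
    then have "r = Fract (a * g) (b * g)"
      using mult_fract_cancel[of g a b] r(1) by (simp add: mult.commute)
    then show "r \<in> stalk I p"
      using r g vanishes_at_mult_iff[OF p(1) r(3) g(2)]
      by (auto intro!: stalkI[of _ _ "int n + int N"] mult_mem homogeneous_mult)
  qed
qed

lemma stalk_uminus:
  assumes "p \<in> proj_plane" "r \<in> stalk I p"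
  shows "- r \<in> stalk I p"
proof -
  have "const_fract (- 1) = (- 1 :: 'k mpoly3 fract)"
    by (simp only: const_fract_def mterm_minus[symmetric] mterm_1 One_fract_def minus_fract)
  then show ?thesis
    using stalk_mult[OF assms(1) const_fract_in_local_ring[OF assms(1)] assms(2), of "- 1"] by simp
qed

lemma subspace_zero_section_reps: "module.subspace scale_section (zero_section_reps I)"
proof -
  interpret vector_space scale_section by (rule vector_space_scale_section)
  show ?thesis
    unfolding subspace_def zero_section_reps_def
    by (simp add: stalk_0 stalk_add scale_section_apply stalk_mult const_fract_in_local_ring)
qed

text \<open>
  The structure sheaf of the scheme is a skyscraper sheaf. Near \<open>(0 : 0 : 1)\<close> the given fraction itself
  is a regular function with the required classes, because elsewhere all classes are zero; on the
  complement of the point the zero function works.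
\<close>

lemma skyscraper_in_section_reps:
  assumes "r \<in> local_ring origin"
  shows "(\<lambda>p. if p = origin then r else 0) \<in> section_reps I" (is "?s \<in> _")
  unfolding section_reps_def
proof (intro CollectI ballI conjI)
  have local_ring_0: "0 \<in> local_ring p" if "p \<in> proj_plane" for p :: "('k ^ 3) set"
    unfolding Zero_fract_def
    by (rule stalkI[OF UNIV_I homogeneous_0 homogeneous_1 not_vanishes_at_1[OF that]])
  obtain a b n where r: "r = Fract a b" "homogeneous (int n) a" "homogeneous (int n) b"
      "\<not> vanishes_at b origin" using assms by (rule stalkE)
  fix p :: "('k ^ 3) set" assume p: "p \<in> proj_plane"
  show "?s p \<in> local_ring p" using assms local_ring_0[OF p] by simp
  show "\<exists>U t. zariski_open U \<and> p \<in> U \<and> (\<forall>q\<in>U. t \<in> local_ring q \<and> ?s q - t \<in> stalk I q)"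
  proof (cases "p = origin")
    case True
    let ?U = "{q \<in> proj_plane. \<exists>g\<in>{b}. \<not> vanishes_at g q}"
    have equals_r: "r \<in> local_ring q \<and> ?s q - r \<in> stalk I q" if "q \<in> ?U" for q
    proof -
      have q: "q \<in> proj_plane" and r_q: "r \<in> local_ring q"
        using that r by (auto intro: stalkI)
      show ?thesis
      proof (cases "q = origin")
        case True
        then show ?thesis using r_q stalk_0[OF q] by simp
      next
        case False
        then show ?thesis using r_q stalk_uminus[OF q] stalk_eq_local_ring[OF q] by simp
      qed
    qed
    have "zariski_open ?U" unfolding zariski_open_def using r(3) by blast
    moreover have "p \<in> ?U" using True p r(4) by simp
    ultimately have "zariski_open ?U \<and> p \<in> ?U \<and> (\<forall>q\<in>?U. r \<in> local_ring q \<and> ?s q - r \<in> stalk I q)"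
      using ballI[OF equals_r, of ?U] by (rule conjI[OF _ conjI])
    then show ?thesis by - (rule exI, rule exI)
  next
    case False
    let ?T = "{mterm 1 1 0 0, mterm 1 0 1 0} :: 'k mpoly3 set"
    let ?U = "{q \<in> proj_plane. \<exists>g\<in>?T. \<not> vanishes_at g q}"
    have equals_0: "0 \<in> local_ring q \<and> ?s q - 0 \<in> stalk I q" if "q \<in> ?U" for q
    proof -
      have "vanishes_at (mterm 1 1 0 0 :: 'k mpoly3) origin" "vanishes_at (mterm 1 0 1 0 :: 'k mpoly3) origin"
        by (simp_all add: vanishes_at_origin_mterm_iff)
      then have "q \<in> proj_plane" "q \<noteq> origin" using that by auto
      then show ?thesis using stalk_0 local_ring_0 by simp
    qed
    have "zariski_open ?U"
      unfolding zariski_open_def by (intro exI[of _ ?T]) (blast intro: homogeneous_mterm)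
    moreover have "p \<in> ?U" by (rule other_point_cases[OF p False]) (use p in simp_all)
    ultimately have "zariski_open ?U \<and> p \<in> ?U \<and> (\<forall>q\<in>?U. 0 \<in> local_ring q \<and> ?s q - 0 \<in> stalk I q)"
      using ballI[OF equals_0, of ?U] by (rule conjI[OF _ conjI])
    then show ?thesis by - (rule exI, rule exI)
  qed
qed

text \<open>
  Global sections are thus the elements of the quotient of the local ring at \<open>(0 : 0 : 1)\<close> by the
  stalk of the ideal.
\<close>

lemma h0_eq_card_local_basis:
  assumes fin: "finite B" and e: "\<And>i. i \<in> B \<Longrightarrow> e i \<in> local_ring origin"
    and span: "\<And>r. r \<in> local_ring origin \<Longrightarrow>
      \<exists>c. r - (\<Sum>i\<in>B. const_fract (c i) * e i) \<in> stalk I origin"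
    and indep: "\<And>c i. (\<Sum>i\<in>B. const_fract (c i) * e i) \<in> stalk I origin \<Longrightarrow> i \<in> B \<Longrightarrow> c i = 0"
  shows "h0_structure_sheaf I = card B"
proof -
  define s where "s = (\<lambda>i (p :: ('k ^ 3) set). if p = origin then e i else 0)"
  have at_origin: "(\<Sum>i\<in>B. scale_section (c i) (s i)) origin = (\<Sum>i\<in>B. const_fract (c i) * e i)" for c
    by (simp add: sum_fun_apply scale_section_apply s_def)
  show ?thesis
    unfolding h0_structure_sheaf_def
  proof (rule quotient_dim_eq_card[OF vector_space_scale_section subspace_zero_section_reps fin])
    show "s i \<in> section_reps I" if "i \<in> B" for i
      unfolding s_def by (rule skyscraper_in_section_reps[OF e[OF that]])
  next
    fix v assume v: "v \<in> section_reps I"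
    then have v_local: "v p \<in> local_ring p" if "p \<in> proj_plane" for p
      using that unfolding section_reps_def by blast
    obtain c where c: "v origin - (\<Sum>i\<in>B. const_fract (c i) * e i) \<in> stalk I origin"
      using span[OF v_local[OF origin_in_proj_plane]] by blast
    have "(v - (\<Sum>i\<in>B. scale_section (c i) (s i))) p \<in> stalk I p" if p: "p \<in> proj_plane" for p
    proof (cases "p = origin")
      case True
      then show ?thesis using c by (simp add: at_origin)
    next
      case False
      then have "(\<Sum>i\<in>B. scale_section (c i) (s i)) p = 0"
        by (simp add: sum_fun_apply scale_section_apply s_def)
      then show ?thesis using v_local[OF p] stalk_eq_local_ring[OF p False] by simp
    qed
    then show "\<exists>c. v - (\<Sum>i\<in>B. scale_section (c i) (s i)) \<in> zero_section_reps I"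
      unfolding zero_section_reps_def by blast
  next
    fix c i assume "(\<Sum>i\<in>B. scale_section (c i) (s i)) \<in> zero_section_reps I" "i \<in> B"
    then have "(\<Sum>i\<in>B. scale_section (c i) (s i)) origin \<in> stalk I origin"
      using origin_in_proj_plane unfolding zero_section_reps_def by blast
    then show "c i = 0"
      unfolding at_origin using \<open>i \<in> B\<close> by (rule indep)
  qed
qed

end

section \<open>Local algebras with a dual basis\<close>

text \<open>
  Membership in the \<open>n\<close>-th power of the ideal \<open>(x, y)\<close>.
\<close>

definition xy_order_ge :: "nat \<Rightarrow> 'k::field mpoly3 \<Rightarrow> bool" where
  "xy_order_ge n f \<longleftrightarrow> (\<forall>i j l. expo i j l \<in> Poly_Mapping.keys f \<longrightarrow> n \<le> i + j)"

lemma xy_order_ge_power: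
  assumes "xy_order_ge 1 f"
  shows "xy_order_ge n (f ^ n)"
proof (induction n)
  case (Suc n)
  show ?case
    unfolding xy_order_ge_def
  proof (intro allI impI)
    fix i j l assume "expo i j l \<in> Poly_Mapping.keys (f ^ Suc n)"
    then obtain m m' where m: "m \<in> Poly_Mapping.keys f" "m' \<in> Poly_Mapping.keys (f ^ n)"
        "expo i j l = m + m'"
      using subsetD[OF keys_mult, of _ f "f ^ n"] unfolding power_Suc by blast
    have "1 \<le> Poly_Mapping.lookup m 1 + Poly_Mapping.lookup m 2"
      using m(1) assms unfolding xy_order_ge_def by (metis expo_lookups)
    moreover have "n \<le> Poly_Mapping.lookup m' 1 + Poly_Mapping.lookup m' 2"
      using m(2) Suc unfolding xy_order_ge_def by (metis expo_lookups)
    moreover have "i = Poly_Mapping.lookup (m + m') 1" "j = Poly_Mapping.lookup (m + m') 2"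
      unfolding m(3)[symmetric] by simp_all
    ultimately show "Suc n \<le> i + j" by (simp add: lookup_add)
  qed
qed (simp add: xy_order_ge_def)

text \<open>
  Linear forms that ignore the exponent of \<open>z\<close>, that is, linear forms on the affine coordinate ring
  \<open>k[x, y]\<close> of the chart \<open>z = 1\<close>; \<open>t i j\<close> is the value at \<open>x\<^sup>i y\<^sup>j\<close>.
\<close>

definition pairing :: "(nat \<Rightarrow> nat \<Rightarrow> 'k::field) \<Rightarrow> 'k mpoly3 \<Rightarrow> 'k" where
  "pairing t = termwise (\<lambda>m c. c * t (Poly_Mapping.lookup m 1) (Poly_Mapping.lookup m 2))"

lemma termwise_additive_pairing:
  "termwise_additive (\<lambda>m (c::'k::field). c * t (Poly_Mapping.lookup m 1) (Poly_Mapping.lookup m 2))"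
  by unfold_locales (simp_all add: distrib_right)

lemma pairing_mterm: "pairing t (mterm c i j l) = c * t i j"
  unfolding pairing_def by (subst termwise_additive.termwise_mterm[OF termwise_additive_pairing]) simp

lemma pairing_add: "pairing t (f + g) = pairing t f + pairing t g"
  unfolding pairing_def by (rule termwise_additive.termwise_add[OF termwise_additive_pairing])

lemma pairing_sum: "pairing t (\<Sum>i\<in>A. g i) = (\<Sum>i\<in>A. pairing t (g i))"
  unfolding pairing_def by (rule termwise_additive.termwise_sum[OF termwise_additive_pairing])

lemma pairing_0 [simp]: "pairing t 0 = 0"
  by (simp add: pairing_def termwise_def)

context punctual_ideal
begin

text \<open>
  A monomial \<open>x\<^sup>i y\<^sup>j\<close> with \<open>i + j \<ge> 2 N\<close> has \<open>i \<ge> N\<close> or \<open>j \<ge> N\<close>.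
\<close>

lemma xy_order_ge_imp_mem:
  assumes "xy_order_ge (2 * N) f"
  shows "f \<in> I"
proof (induction f rule: mpoly3_additive_induct)
  case (mterm i j l)
  let ?c = "Poly_Mapping.lookup f (expo i j l)"
  have "N \<le> i \<or> N \<le> j" using assms mterm unfolding xy_order_ge_def by force
  then show ?case
  proof
    assume "N \<le> i"
    then have "mterm ?c i j l = mterm ?c (i - N) j l * mterm 1 N 0 0" by (simp add: mterm_mult)
    then show ?thesis using mult_mem[OF x_power] by simp
  next
    assume "N \<le> j"
    then have "mterm ?c i j l = mterm ?c i (j - N) l * mterm 1 0 N 0" by (simp add: mterm_mult)
    then show ?thesis using mult_mem[OF y_power] by simp
  qed
qed (simp_all add: zero_mem add_mem)

text \<open>
  A denominator \<open>b\<close> that does not vanish at the point is invertible modulo the ideal up to a power of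
  \<open>z\<close>. Indeed \<open>b = \<beta> z\<^sup>n - u\<close> with \<open>u\<close> in \<open>(x, y)\<close>, and \<open>b\<close> divides \<open>(\<beta> z\<^sup>n)\<^sup>M - u\<^sup>M\<close>, where \<open>u\<^sup>M\<close> lies in the ideal
  for large \<open>M\<close>.
\<close>

lemma inverse_modulo:
  assumes b: "homogeneous (int n) b" "\<not> vanishes_at b origin"
  obtains w \<beta> where "\<beta> \<noteq> 0" "homogeneous (int (n * (2 * N))) w"
    "b * w - mterm \<beta> 0 0 (n * (2 * N + 1)) \<in> I"
proof -
  define \<beta> where "\<beta> = Poly_Mapping.lookup b (expo 0 0 n)"
  have "\<beta> \<noteq> 0"
    using b eval3_axis_3[OF b(1)] vanishes_at_iff[OF b(1) origin_eq_multiples] by (simp add: \<beta>_def)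
  let ?z = "mterm \<beta> 0 0 n"
  define u where "u = ?z - b"
  have u: "homogeneous (int n) u"
    unfolding u_def by (rule homogeneous_diff[OF homogeneous_mterm b(1)]) simp
  have "xy_order_ge 1 u"
    unfolding xy_order_ge_def
  proof (intro allI impI, rule ccontr)
    fix i j l assume key: "expo i j l \<in> Poly_Mapping.keys u" and "\<not> 1 \<le> i + j"
    then have ij: "i = 0" "j = 0" by auto
    then have "l = n" using u key unfolding homogeneous_iff by force
    then have "Poly_Mapping.lookup u (expo i j l) = 0"
      using ij by (simp add: u_def lookup_minus lookup_mterm \<beta>_def)
    then show False using key by (simp add: in_keys_iff)
  qed
  \<comment> \<open>One more than the exponent \<open>2 N\<close> that would do for \<open>u\<close>: the degree of the geometric sum \<open>w\<close>
    is then \<open>n * (2 * N)\<close>, without a truncated subtraction when \<open>N = 0\<close>.\<close>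
  let ?M = "2 * N + 1"
  have "xy_order_ge ?M (u ^ ?M)" by (rule xy_order_ge_power) fact
  then have u_power: "u ^ ?M \<in> I"
    by (intro xy_order_ge_imp_mem) (force simp: xy_order_ge_def)
  define w where "w = (\<Sum>i<?M. u ^ (?M - Suc i) * ?z ^ i)"
  have "homogeneous (int (n * (2 * N))) w"
    unfolding w_def
  proof (rule homogeneous_sum)
    fix i assume "i \<in> {..<?M}"
    then have "n * (2 * N) = (?M - Suc i) * n + i * n" by (simp flip: distrib_right)
    then have "int (n * (2 * N)) = int (?M - Suc i) * int n + int i * int n"
      by (metis of_nat_add of_nat_mult)
    moreover have "homogeneous (int n) ?z" by (rule homogeneous_mterm) simp
    ultimately show "homogeneous (int (n * (2 * N))) (u ^ (?M - Suc i) * ?z ^ i)"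
      using homogeneous_mult[OF homogeneous_power[OF u] homogeneous_power] by metis
  qed
  moreover have "?z ^ ?M - u ^ ?M = b * w"
    unfolding w_def power_diff_sumr2 by (simp add: u_def)
  then have "b * w - ?z ^ ?M = (- 1) * u ^ ?M" by (simp add: algebra_simps)
  then have "b * w - ?z ^ ?M \<in> I" using mult_mem[OF u_power, of "- 1"] by metis
  then have "b * w - mterm (\<beta> ^ ?M) 0 0 (n * (2 * N + 1)) \<in> I"
    by (simp only: mterm_power mult_0_right mult.commute[of ?M n])
  moreover have "\<beta> ^ ?M \<noteq> 0" using \<open>\<beta> \<noteq> 0\<close> by simp
  ultimately show thesis using that by blast
qed

end

text \<open>
  A certificate that the monomials \<open>x\<^sup>i y\<^sup>j\<close> with \<open>(i, j)\<close> in \<open>B\<close> form a basis of the local algebra.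
  Spanning is certified by \<open>reduce\<close>: every monomial is, after multiplication by \<open>z\<close>, congruent to
  a scalar multiple of one basis monomial times a power of \<open>z\<close>. The bound \<open>K\<close> keeps the exponent
  of that power from being truncated. Independence is certified by a linear form that kills the ideal and
  for which the monomials with exponents \<open>dual b\<close> are, up to scaling, a dual basis. Since the
  singularities considered here are quasi-homogeneous, their local algebras are Gorenstein, and such a
  linear form exists: it is a form that does not vanish on the socle.
\<close>

locale punctual_ideal_with_dual_basis = punctual_ideal I N
  for I :: "'k::field_char_0 mpoly3 set" and N +
  fixes B :: "(nat \<times> nat) set" and t :: "nat \<Rightarrow> nat \<Rightarrow> 'k" and dual :: "nat \<times> nat \<Rightarrow> nat \<times> nat"
    and K :: nat
  assumes finite_B: "finite B"
    and B_degree: "b \<in> B \<Longrightarrow> fst b + snd b \<le> K"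
    and pairing_ideal: "f \<in> I \<Longrightarrow> pairing t f = 0"
    and dual: "b \<in> B \<Longrightarrow> b' \<in> B \<Longrightarrow>
      t (fst b + fst (dual b')) (snd b + snd (dual b')) = 0 \<longleftrightarrow> b \<noteq> b'"
    and reduce: "\<exists>b\<in>B. \<exists>c. \<forall>l. K \<le> i + j + l \<longrightarrow>
      mterm 1 i j (l + 1) - mterm c (fst b) (snd b) (i + j + l + 1 - (fst b + snd b)) \<in> I"
begin

text \<open>
  The homogeneous polynomial of degree \<open>n\<close> whose restriction to the chart \<open>z = 1\<close> is the linear
  combination of the basis monomials with coefficients \<open>c\<close>; the degree is correct for \<open>n \<ge> K\<close>.
\<close>

definition combination :: "nat \<Rightarrow> (nat \<times> nat \<Rightarrow> 'k) \<Rightarrow> 'k mpoly3" where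
  "combination n c = (\<Sum>b\<in>B. mterm (c b) (fst b) (snd b) (n - (fst b + snd b)))"

lemma homogeneous_combination:
  assumes "K \<le> n"
  shows "homogeneous (int n) (combination n c)"
  unfolding combination_def using assms B_degree
  by (intro homogeneous_sum homogeneous_mterm) force

lemma combination_add: "combination n c + combination n c' = combination n (\<lambda>b. c b + c' b)"
  by (simp add: combination_def sum.distrib flip: mterm_add)

lemma reduce_homogeneous:
  assumes f: "homogeneous (int n) f" and n: "K \<le> n"
  shows "\<exists>c. mterm 1 0 0 1 * f - combination (n + 1) c \<in> I"
proof (induction f rule: mpoly3_additive_induct)
  case zero
  have "combination (n + 1) (\<lambda>b. 0) = 0" by (simp add: combination_def)
  then show ?case by (intro exI[of _ "\<lambda>b. 0"]) (simp add: zero_mem)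
next
  case (add f g)
  then obtain c c' where "mterm 1 0 0 1 * f - combination (n + 1) c \<in> I"
      "mterm 1 0 0 1 * g - combination (n + 1) c' \<in> I" by blast
  then have "(mterm 1 0 0 1 * f - combination (n + 1) c) + (mterm 1 0 0 1 * g - combination (n + 1) c') \<in> I"
    by (rule add_mem)
  also have "(mterm 1 0 0 1 * f - combination (n + 1) c) + (mterm 1 0 0 1 * g - combination (n + 1) c') =
      mterm 1 0 0 1 * (f + g) - combination (n + 1) (\<lambda>b. c b + c' b)"
    unfolding combination_add[symmetric] by (simp add: algebra_simps)
  finally have "mterm 1 0 0 1 * (f + g) - combination (n + 1) (\<lambda>b. c b + c' b) \<in> I" .
  then show ?case by blast
next
  case (mterm i j l)
  let ?a = "Poly_Mapping.lookup f (expo i j l)"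
  have l: "i + j + l = n" using f mterm unfolding homogeneous_iff by force
  obtain b c where b: "b \<in> B" and c: "mterm 1 i j (l + 1) -
      mterm c (fst b) (snd b) (i + j + l + 1 - (fst b + snd b)) \<in> I"
    using reduce[of i j] n l by blast
  have "combination (n + 1) (\<lambda>b'. if b' = b then ?a * c else 0) =
      (\<Sum>b'\<in>B. if b' = b then mterm (?a * c) (fst b) (snd b) (n + 1 - (fst b + snd b)) else 0)"
    unfolding combination_def by (rule sum.cong) auto
  also have "\<dots> = mterm (?a * c) (fst b) (snd b) (n + 1 - (fst b + snd b))"
    using b finite_B by simp
  finally have "mterm 1 0 0 1 * mterm ?a i j l - combination (n + 1) (\<lambda>b'. if b' = b then ?a * c else 0) =
      mterm ?a 0 0 0 * (mterm 1 i j (l + 1) - mterm c (fst b) (snd b) (i + j + l + 1 - (fst b + snd b)))"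
    by (simp add: right_diff_distrib mterm_mult l)
  then show ?case using mult_mem[OF c] by metis
qed

definition local_monomial :: "nat \<times> nat \<Rightarrow> 'k mpoly3 fract" where
  "local_monomial b = Fract (mterm 1 (fst b) (snd b) 0) (mterm 1 0 0 (fst b + snd b))"

lemma sum_local_monomials:
  assumes "K \<le> n"
  shows "(\<Sum>b\<in>B. const_fract (c b) * local_monomial b) = Fract (combination n c) (mterm 1 0 0 n)"
proof -
  have one: "const_fract (c b) * local_monomial b =
      Fract (mterm (c b) (fst b) (snd b) (n - (fst b + snd b))) (mterm 1 0 0 n)" if "b \<in> B" for b
    using B_degree[OF that] assms
    by (simp add: local_monomial_def const_fract_def eq_fract mterm_mult)
  have "(\<Sum>b\<in>A. const_fract (c b) * local_monomial b) =
      Fract (\<Sum>b\<in>A. mterm (c b) (fst b) (snd b) (n - (fst b + snd b))) (mterm 1 0 0 n)"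
    if "finite A" "A \<subseteq> B" for A
    using that
  proof (induction A)
    case empty
    then show ?case by (simp add: fract_collapse)
  next
    case (insert b A)
    then have "(\<Sum>b\<in>insert b A. const_fract (c b) * local_monomial b) =
        Fract (mterm (c b) (fst b) (snd b) (n - (fst b + snd b))) (mterm 1 0 0 n) +
        Fract (\<Sum>b\<in>A. mterm (c b) (fst b) (snd b) (n - (fst b + snd b))) (mterm 1 0 0 n)"
      by (simp add: one)
    also have "\<dots> = Fract (\<Sum>b\<in>insert b A. mterm (c b) (fst b) (snd b) (n - (fst b + snd b))) (mterm 1 0 0 n)"
      using insert.hyps by (simp add: eq_fract algebra_simps)
    finally show ?case .
  qed
  from this[OF finite_B subset_refl] show ?thesis by (simp add: combination_def)
qed

text \<open>
  A fraction \<open>a / b\<close> is congruent to \<open>a w / (\<beta> z\<^sup>L)\<close>, where \<open>w\<close> inverts \<open>b\<close> up to \<open>\<beta> z\<^sup>L\<close>, and the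
  numerator reduces to a combination of basis monomials once its degree is at least \<open>K\<close>.
\<close>

lemma local_monomials_span:
  assumes "r \<in> local_ring origin"
  shows "\<exists>c. r - (\<Sum>b\<in>B. const_fract (c b) * local_monomial b) \<in> stalk I origin"
proof -
  obtain a b n where r: "r = Fract a b" "homogeneous (int n) a" "homogeneous (int n) b"
    "\<not> vanishes_at b origin" "b \<noteq> 0" using assms by (rule stalkE)
  obtain w \<beta> where w: "\<beta> \<noteq> 0" "homogeneous (int (n * (2 * N))) w"
      "b * w - mterm \<beta> 0 0 (n * (2 * N + 1)) \<in> I"
    using inverse_modulo[OF r(3,4)] .
  define L where "L = n * (2 * N + 1)"
  \<comment> \<open>The factor \<open>z\<^sup>K\<close> raises the degree to the range in which monomials can be reduced.\<close>
  define a' where "a' = mterm (inverse \<beta>) 0 0 K * (a * w)"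
  have "homogeneous (int K + (int n + int (n * (2 * N)))) a'"
    unfolding a'_def by (intro homogeneous_mult r w homogeneous_mterm) simp
  then have "homogeneous (int (L + K)) a'" by (simp add: L_def algebra_simps)
  then obtain c where c: "mterm 1 0 0 1 * a' - combination (L + K + 1) c \<in> I"
    using reduce_homogeneous[of "L + K" a'] by auto
  let ?S = "combination (L + K + 1) c"
  let ?z = "mterm 1 0 0 (L + K + 1) :: 'k mpoly3"
  let ?g = "mterm (inverse \<beta>) 0 0 (K + 1)"
  have z: "?z = ?g * mterm \<beta> 0 0 L"
    using w(1) by (simp add: mterm_mult add_ac)
  have za': "mterm 1 0 0 1 * a' = ?g * (a * w)"
    by (simp add: a'_def mterm_mult flip: mult.assoc)
  have "a * ?z - ?S * b = b * (mterm 1 0 0 1 * a' - ?S) - (?g * a) * (b * w - mterm \<beta> 0 0 L)"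
    unfolding z za' by (simp add: algebra_simps)
  also have "\<dots> \<in> I"
    by (rule diff_mem[OF mult_mem[OF c] mult_mem[OF w(3)[folded L_def]]])
  finally have in_I: "a * ?z - ?S * b \<in> I" .
  have S: "homogeneous (int (L + K + 1)) ?S" by (rule homogeneous_combination) simp
  have z_hom: "homogeneous (int (L + K + 1)) ?z" by (rule homogeneous_mterm) simp
  have "homogeneous (int n + int (L + K + 1)) (a * ?z - ?S * b)"
    using homogeneous_mult[OF r(2) z_hom] homogeneous_mult[OF S r(3)]
    by (intro homogeneous_diff) (simp_all add: add.commute)
  moreover have "\<not> vanishes_at (b * ?z) origin"
    unfolding vanishes_at_mult_iff[OF origin_in_proj_plane r(3) z_hom]
    using r(4) by (simp add: vanishes_at_origin_mterm_iff)
  ultimately have "Fract (a * ?z - ?S * b) (b * ?z) \<in> stalk I origin"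
    using in_I homogeneous_mult[OF r(3) z_hom] by (intro stalkI)
  moreover have "r - Fract ?S ?z = Fract (a * ?z - ?S * b) (b * ?z)"
    using r(1,5) by simp
  moreover have "(\<Sum>b\<in>B. const_fract (c b) * local_monomial b) = Fract ?S ?z"
    by (rule sum_local_monomials) simp
  ultimately show ?thesis by metis
qed

text \<open>
  If a combination \<open>S\<close> of basis monomials is zero in the local algebra, then \<open>S b\<close> lies in the ideal for
  some \<open>b\<close> not vanishing at the point. Inverting \<open>b\<close> shows that \<open>S\<close> times a power of \<open>z\<close> lies in the
  ideal, and pairing with the monomial dual to \<open>b\<^sub>0\<close> extracts the coefficient at \<open>b\<^sub>0\<close>.
\<close>

lemma local_monomials_independent:
  assumes stalk: "(\<Sum>b\<in>B. const_fract (c b) * local_monomial b) \<in> stalk I origin" and b\<^sub>0: "b\<^sub>0 \<in> B"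
  shows "c b\<^sub>0 = 0"
proof -
  let ?S = "combination K c"
  obtain a b n where ab: "Fract ?S (mterm 1 0 0 K) = Fract a b" "a \<in> I" "homogeneous (int n) b"
    "\<not> vanishes_at b origin" "b \<noteq> 0"
    using stalk unfolding sum_local_monomials[OF order.refl] by (rule stalkE)
  then have "?S * b = mterm 1 0 0 K * a" by (simp add: eq_fract mult.commute)
  then have Sb: "?S * b \<in> I" using mult_mem[OF ab(2)] by metis
  obtain w \<beta> where w: "\<beta> \<noteq> 0" "b * w - mterm \<beta> 0 0 (n * (2 * N + 1)) \<in> I"
    using inverse_modulo[OF ab(3,4)] by metis
  let ?L = "n * (2 * N + 1)"
  let ?d = "mterm 1 (fst (dual b\<^sub>0)) (snd (dual b\<^sub>0)) 0 :: 'k mpoly3"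
  have "?d * (mterm \<beta> 0 0 ?L * ?S) =
      ?d * (w * (?S * b) - ?S * (b * w - mterm \<beta> 0 0 ?L))"
    by (simp add: algebra_simps)
  also have "\<dots> \<in> I" by (rule mult_mem[OF diff_mem[OF mult_mem[OF Sb] mult_mem[OF w(2)]]])
  finally have "pairing t (?d * (mterm \<beta> 0 0 ?L * ?S)) = 0" by (rule pairing_ideal)
  also have "?d * (mterm \<beta> 0 0 ?L * ?S) = (\<Sum>b\<in>B. mterm (\<beta> * c b)
      (fst b + fst (dual b\<^sub>0)) (snd b + snd (dual b\<^sub>0)) (?L + (K - (fst b + snd b))))"
    by (simp add: combination_def sum_distrib_left mterm_mult add.commute)
  also have "pairing t \<dots> = (\<Sum>b\<in>B. \<beta> * c b * t (fst b + fst (dual b\<^sub>0)) (snd b + snd (dual b\<^sub>0)))"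
    by (simp add: pairing_sum pairing_mterm)
  also have "\<dots> = (\<Sum>b\<in>B. if b = b\<^sub>0 then \<beta> * c b * t (fst b + fst (dual b\<^sub>0)) (snd b + snd (dual b\<^sub>0)) else 0)"
    by (rule sum.cong) (use dual b\<^sub>0 in auto)
  also have "\<dots> = \<beta> * c b\<^sub>0 * t (fst b\<^sub>0 + fst (dual b\<^sub>0)) (snd b\<^sub>0 + snd (dual b\<^sub>0))"
    using finite_B b\<^sub>0 by simp
  finally show ?thesis using w(1) dual[OF b\<^sub>0 b\<^sub>0] by simp
qed

lemma h0_eq_card: "h0_structure_sheaf I = card B"
proof (rule h0_eq_card_local_basis[OF finite_B, of local_monomial])
  show "local_monomial b \<in> local_ring origin" for b
    unfolding local_monomial_def
    by (rule stalkI[of _ _ "int (fst b + snd b)"])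
      (simp_all add: homogeneous_mterm vanishes_at_origin_mterm_iff)
qed (fact local_monomials_span, rule local_monomials_independent)

end

section \<open>Jacobian ideals and syzygies of low degree\<close>

lemma jacobian_ideal_iff:
  "g \<in> jacobian_ideal f \<longleftrightarrow> (\<exists>a b c. g = a * pdiff 1 f + b * pdiff 2 f + c * pdiff 3 f)"
proof
  assume "\<exists>a b c. g = a * pdiff 1 f + b * pdiff 2 f + c * pdiff 3 f"
  then obtain a b c where "g = a * pdiff 1 f + b * pdiff 2 f + c * pdiff 3 f" by blast
  then have "g = (\<Sum>i\<in>UNIV. (\<chi> i. if i = 1 then a else if i = 2 then b else c) $ i * pdiff i f)"
    by (simp add: sum_3)
  then show "g \<in> jacobian_ideal f" unfolding jacobian_ideal_def by blast
qed (auto simp: jacobian_ideal_def sum_3)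

lemma jacobian_idealI:
  "g = a * pdiff 1 f + b * pdiff 2 f + c * pdiff 3 f \<Longrightarrow> g \<in> jacobian_ideal f"
  unfolding jacobian_ideal_iff by blast

lemma punctual_jacobian_ideal:
  assumes "mterm 1 N 0 0 \<in> jacobian_ideal f" "mterm 1 0 N 0 \<in> jacobian_ideal f"
  shows "punctual_ideal (jacobian_ideal f) N"
proof
  show "0 \<in> jacobian_ideal f"
    by (rule jacobian_idealI[of _ 0 _ 0 0]) simp
  show "g + h \<in> jacobian_ideal f" if "g \<in> jacobian_ideal f" "h \<in> jacobian_ideal f" for g h
  proof -
    obtain a b c where g: "g = a * pdiff 1 f + b * pdiff 2 f + c * pdiff 3 f"
      using \<open>g \<in> _\<close> unfolding jacobian_ideal_iff by blast
    obtain a' b' c' where h: "h = a' * pdiff 1 f + b' * pdiff 2 f + c' * pdiff 3 f"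
      using \<open>h \<in> _\<close> unfolding jacobian_ideal_iff by blast
    show ?thesis
      by (rule jacobian_idealI[of _ "a + a'" _ "b + b'" "c + c'"]) (simp add: g h algebra_simps)
  qed
  show "h * g \<in> jacobian_ideal f" if "g \<in> jacobian_ideal f" for g h
  proof -
    obtain a b c where g: "g = a * pdiff 1 f + b * pdiff 2 f + c * pdiff 3 f"
      using \<open>g \<in> _\<close> unfolding jacobian_ideal_iff by blast
    show ?thesis
      by (rule jacobian_idealI[of _ "h * a" _ "h * b" "h * c"]) (simp add: g algebra_simps)
  qed
qed (fact assms)+

lemma pairing_jacobian_ideal_eq_0:
  assumes "g \<in> jacobian_ideal f"
    and partial: "\<And>i j l v. pairing t (mterm 1 i j l * pdiff v f) = 0"
  shows "pairing t g = 0"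
proof -
  have scale: "pairing t (mterm c 0 0 0 * h) = c * pairing t h" for c h
    by (induction h rule: mpoly3_additive_induct)
      (simp_all add: distrib_left pairing_add mterm_mult pairing_mterm)
  have "pairing t (h * pdiff v f) = 0" for h v
  proof (induction h rule: mpoly3_additive_induct)
    case (mterm i j l)
    have "mterm (Poly_Mapping.lookup h (expo i j l)) i j l * pdiff v f =
        mterm (Poly_Mapping.lookup h (expo i j l)) 0 0 0 * (mterm 1 i j l * pdiff v f)"
      by (simp add: mterm_mult flip: mult.assoc)
    then show ?case by (simp only: scale partial mult_zero_right)
  qed (simp_all add: distrib_right pairing_add)
  then show ?thesis
    using assms(1) unfolding jacobian_ideal_iff by (auto simp: pairing_add)
qed

text \<open>
  A syzygy of degree zero is a linear relation with constant coefficients between the partial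
  derivatives.
\<close>

lemma min_syzygy_degree_eq_1:
  fixes f :: "'k::field mpoly3"
  assumes "a \<in> syzygies f 1" "a \<noteq> 0"
    and const_relation: "\<And>p q r. mterm p 0 0 0 * pdiff 1 f + mterm q 0 0 0 * pdiff 2 f +
      mterm r 0 0 0 * pdiff 3 f = 0 \<Longrightarrow> p = 0 \<and> q = 0 \<and> r = 0"
  shows "min_syzygy_degree f = 1"
  unfolding min_syzygy_degree_def
proof (rule Least_equality)
  show "syzygies f 1 \<noteq> {0}" using assms(1,2) by blast
next
  fix m assume m: "syzygies f m \<noteq> {0}"
  have "0 \<in> syzygies f m" by (simp add: syzygies_def)
  then obtain b where b: "b \<in> syzygies f m" "b \<noteq> 0" using m by blast
  then have hom: "homogeneous m (b $ i)" for i unfolding syzygies_def by blast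
  obtain i where i: "b $ i \<noteq> 0" using b(2) by (metis vec_eq_iff zero_index)
  have "m \<noteq> 0"
  proof
    assume "m = 0"
    then have "\<exists>c. b $ i = mterm c 0 0 0" for i
      using homogeneous_degree_0 hom by blast
    then obtain c where c: "\<And>i. b $ i = mterm (c i) 0 0 0" by metis
    have "(\<Sum>i\<in>UNIV. b $ i * pdiff i f) = 0"
      using b(1) unfolding syzygies_def by blast
    then have "c 1 = 0 \<and> c 2 = 0 \<and> c 3 = 0"
      by (intro const_relation) (simp add: c sum_3)
    then show False using i c exhaust_3[of i] by auto
  qed
  moreover have "0 \<le> m" using homogeneous_neg[OF hom] i by force
  ultimately show "1 \<le> m" by simp
qed

lemma vanishes_at_add: "vanishes_at f p \<Longrightarrow> vanishes_at g p \<Longrightarrow> vanishes_at (f + g) p"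
  by (simp add: vanishes_at_def eval3_add)

text \<open>
  All terms of the polynomial and of its partial derivatives involve \<open>x\<close> or \<open>y\<close> when \<open>a \<ge> 2\<close> and
  \<open>b + e \<ge> 3\<close>, so the curve is singular at \<open>(0 : 0 : 1)\<close>.
\<close>

lemma reduced_singular_binomial:
  assumes "e \<le> 1" "2 \<le> a" "e + b = a + 1"
  shows "reduced_singular_curve (a + 1) (mterm 1 a 0 1 + mterm 1 e b 0 :: 'k::field mpoly3)"
    (is "reduced_singular_curve _ ?f")
  unfolding reduced_singular_curve_def
proof (intro conjI)
  have "Poly_Mapping.lookup ?f (expo a 0 1) = 1" by (simp add: lookup_add lookup_mterm)
  then show "?f \<noteq> 0" by auto
  show "homogeneous (int (a + 1)) ?f"
    using assms by (intro homogeneous_add homogeneous_mterm) simp_all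
  show "squarefree ?f" by (rule squarefree_binomial) fact
  have "vanishes_at ?f origin"
    using assms by (intro vanishes_at_add) (auto simp: vanishes_at_origin_mterm_iff)
  moreover have "vanishes_at (pdiff i ?f) origin" for i
    using assms exhaust_3[of i]
    by (auto simp: pdiff_add pdiff_mterm vanishes_at_origin_mterm_iff intro!: vanishes_at_add)
  ultimately show "\<exists>p\<in>proj_plane. vanishes_at ?f p \<and> (\<forall>i. vanishes_at (pdiff i ?f) p)"
    using origin_in_proj_plane by blast
qed

section \<open>A cuspidal curve attaining the lower bound\<close>

text \<open>
  The curve \<open>x\<^sup>d\<^sup>-\<^sup>1 z + y\<^sup>d = 0\<close> for \<open>d = k + 2\<close>, with the monomial Jacobian ideal
  \<open>(x\<^sup>k z, y\<^sup>k\<^sup>+\<^sup>1, x\<^sup>k\<^sup>+\<^sup>1)\<close>.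
\<close>

definition cuspidal_curve :: "nat \<Rightarrow> 'k::field mpoly3" where
  "cuspidal_curve k = mterm 1 (k + 1) 0 1 + mterm 1 0 (k + 2) 0"

lemma pdiff_cuspidal_curve:
  "pdiff 1 (cuspidal_curve k) = mterm (of_nat (k + 1)) k 0 1"
  "pdiff 2 (cuspidal_curve k) = mterm (of_nat (k + 2)) 0 (k + 1) 0"
  "pdiff 3 (cuspidal_curve k) = mterm 1 (k + 1) 0 0"
  by (simp_all add: cuspidal_curve_def pdiff_add pdiff_mterm)

lemma jacobian_ideal_cuspidal_curve:
  fixes k :: nat
  defines "I \<equiv> jacobian_ideal (cuspidal_curve k :: 'k::field_char_0 mpoly3)"
  shows "k \<le> i \<Longrightarrow> mterm c i j (l + 1) \<in> I" "k + 1 \<le> j \<Longrightarrow> mterm c i j l \<in> I"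
    "k + 1 \<le> i \<Longrightarrow> mterm c i j l \<in> I"
proof -
  have nz: "of_nat (k + 1) \<noteq> (0::'k)" "of_nat (k + 2) \<noteq> (0::'k)" unfolding of_nat_eq_0_iff by simp_all
  show "k \<le> i \<Longrightarrow> mterm c i j (l + 1) \<in> I"
    unfolding I_def using nz
    by (intro jacobian_idealI[of _ "mterm (c / of_nat (k + 1)) (i - k) j l" _ 0 0])
      (simp add: pdiff_cuspidal_curve mterm_mult)
  show "k + 1 \<le> j \<Longrightarrow> mterm c i j l \<in> I"
    unfolding I_def using nz
    by (intro jacobian_idealI[of _ 0 _ "mterm (c / of_nat (k + 2)) i (j - (k + 1)) l" 0])
      (simp add: pdiff_cuspidal_curve mterm_mult)
  show "k + 1 \<le> i \<Longrightarrow> mterm c i j l \<in> I"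
    unfolding I_def using nz
    by (intro jacobian_idealI[of _ 0 _ 0 "mterm c (i - (k + 1)) j l"])
      (simp add: pdiff_cuspidal_curve mterm_mult)
qed

text \<open>
  The local algebra is \<open>k[x, y] / (x\<^sup>k, y\<^sup>k\<^sup>+\<^sup>1)\<close>, with socle \<open>x\<^sup>k\<^sup>-\<^sup>1 y\<^sup>k\<close>. The linear form takes the
  coefficient of the socle monomial, and the dual of a monomial is its complement in the socle monomial.
\<close>

lemma tjurina_number_cuspidal_curve:
  assumes "1 \<le> k"
  shows "tjurina_number (cuspidal_curve k :: 'k::field_char_0 mpoly3) = k * (k + 1)"
proof -
  let ?I = "jacobian_ideal (cuspidal_curve k :: 'k mpoly3)"
  let ?B = "{..<k} \<times> {..<k + 1}"
  define t where "t = (\<lambda>i j. if i = k - 1 \<and> j = k then 1 else 0 :: 'k)"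
  define dual where "dual = (\<lambda>(i, j). (k - 1 - i, k - j))"
  interpret punctual_ideal ?I "k + 1"
    by (rule punctual_jacobian_ideal) (simp_all add: jacobian_ideal_cuspidal_curve)
  interpret punctual_ideal_with_dual_basis ?I "k + 1" ?B t dual "2 * k"
  proof
    show "finite ?B" by simp
    show "fst b + snd b \<le> 2 * k" if "b \<in> ?B" for b using that by auto
    show "pairing t f = 0" if "f \<in> ?I" for f
    proof (rule pairing_jacobian_ideal_eq_0[OF that])
      fix i j l :: nat and v :: 3
      show "pairing t (mterm 1 i j l * pdiff v (cuspidal_curve k)) = 0"
        using exhaust_3[of v] assms by (auto simp: pdiff_cuspidal_curve mterm_mult pairing_mterm t_def)
    qed
    show "t (fst b + fst (dual b')) (snd b + snd (dual b')) = 0 \<longleftrightarrow> b \<noteq> b'"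
      if "b \<in> ?B" "b' \<in> ?B" for b b'
      using that by (cases b; cases b') (auto simp: t_def dual_def)
    show "\<exists>b\<in>?B. \<exists>c. \<forall>l. 2 * k \<le> i + j + l \<longrightarrow>
      mterm 1 i j (l + 1) - mterm c (fst b) (snd b) (i + j + l + 1 - (fst b + snd b)) \<in> ?I" for i j
    proof (cases "(i, j) \<in> ?B")
      case True
      then show ?thesis by (intro bexI[of _ "(i, j)"] exI[of _ 1]) (simp_all add: zero_mem)
    next
      case False
      then have "mterm 1 i j (l + 1) \<in> ?I" for l
        using jacobian_ideal_cuspidal_curve(1)[of k i 1 j l] jacobian_ideal_cuspidal_curve(2)[of k j 1 i "l + 1"]
        by force
      then show ?thesis using assms by (intro bexI[of _ "(0, 0)"] exI[of _ 0]) simp_all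
    qed
  qed
  show ?thesis unfolding tjurina_number_def h0_eq_card by (simp add: card_cartesian_product)
qed

text \<open>
  The syzygy of degree one is \<open>x f\<^sub>x = (k + 1) z f\<^sub>z\<close>.
\<close>

lemma min_syzygy_degree_cuspidal_curve:
  assumes "1 \<le> k"
  shows "min_syzygy_degree (cuspidal_curve k :: 'k::field_char_0 mpoly3) = 1"
proof (rule min_syzygy_degree_eq_1)
  let ?\<kappa> = "of_nat (k + 1) :: 'k"
  let ?a = "(\<chi> i. if i = 1 then mterm 1 1 0 0 else if i = 2 then 0 else mterm (- ?\<kappa>) 0 0 1) :: 'k mpoly3 ^ 3"
  show "?a \<in> syzygies (cuspidal_curve k) 1"
    by (simp add: syzygies_def sum_3 pdiff_cuspidal_curve mterm_mult mterm_add homogeneous_mterm del: of_nat_add)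
  have "?a $ 1 \<noteq> 0" by simp
  then show "?a \<noteq> 0" by (metis zero_index)
next
  fix p q r :: 'k
  let ?s = "mterm p 0 0 0 * pdiff 1 (cuspidal_curve k) + mterm q 0 0 0 * pdiff 2 (cuspidal_curve k) +
      mterm r 0 0 0 * pdiff 3 (cuspidal_curve k)"
  have nz: "of_nat (k + 1) \<noteq> (0::'k)" "of_nat (k + 2) \<noteq> (0::'k)" unfolding of_nat_eq_0_iff by simp_all
  assume "?s = 0"
  then have "Poly_Mapping.lookup ?s m = 0" for m by simp
  from this[of "expo k 0 1"] this[of "expo 0 (k + 1) 0"] this[of "expo (k + 1) 0 0"]
  show "p = 0 \<and> q = 0 \<and> r = 0"
    using nz by (simp add: pdiff_cuspidal_curve mterm_mult lookup_add lookup_mterm)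
qed

section \<open>A free curve attaining the upper bound\<close>

text \<open>
  The curve \<open>x (x\<^sup>d\<^sup>-\<^sup>2 z + y\<^sup>d\<^sup>-\<^sup>1) = 0\<close> for \<open>d = k + 2\<close>. Attaining the upper bound means that the
  bundle of syzygies splits as a sum of two line bundles, that is, that the curve is free.
\<close>

definition free_curve :: "nat \<Rightarrow> 'k::field mpoly3" where
  "free_curve k = mterm 1 (k + 1) 0 1 + mterm 1 1 (k + 1) 0"

lemma pdiff_free_curve:
  "pdiff 1 (free_curve k) = mterm (of_nat (k + 1)) k 0 1 + mterm 1 0 (k + 1) 0"
  "pdiff 2 (free_curve k) = mterm (of_nat (k + 1)) 1 k 0"
  "pdiff 3 (free_curve k) = mterm 1 (k + 1) 0 0"
  by (simp_all add: free_curve_def pdiff_add pdiff_mterm)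

text \<open>
  The first relation comes from \<open>f\<^sub>x = (k + 1) x\<^sup>k z + y\<^sup>k\<^sup>+\<^sup>1\<close>; combining it with \<open>f\<^sub>y = (k + 1) x y\<^sup>k\<close>
  gives the last one, as \<open>y\<^sup>2\<^sup>k\<^sup>+\<^sup>1 = y\<^sup>k f\<^sub>x - x\<^sup>k\<^sup>-\<^sup>1 z f\<^sub>y\<close>.
\<close>

lemma jacobian_ideal_free_curve:
  fixes k :: nat
  defines "I \<equiv> jacobian_ideal (free_curve k :: 'k::field_char_0 mpoly3)"
  shows "mterm 1 k j (l + 1) - mterm (- 1 / of_nat (k + 1)) 0 (k + 1 + j) l \<in> I"
    "1 \<le> i \<Longrightarrow> k \<le> j \<Longrightarrow> mterm c i j l \<in> I"
    "k + 1 \<le> i \<Longrightarrow> mterm c i j l \<in> I"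
    "1 \<le> k \<Longrightarrow> 2 * k + 1 \<le> j \<Longrightarrow> mterm c i j l \<in> I"
proof -
  let ?\<kappa> = "of_nat (k + 1) :: 'k"
  have nz: "?\<kappa> \<noteq> 0" unfolding of_nat_eq_0_iff by simp
  show "mterm 1 k j (l + 1) - mterm (- 1 / ?\<kappa>) 0 (k + 1 + j) l \<in> I"
    unfolding I_def using nz
    by (intro jacobian_idealI[of _ "mterm (1 / ?\<kappa>) 0 j l" _ 0 0])
      (simp add: pdiff_free_curve mterm_mult distrib_left add_ac del: of_nat_add of_nat_Suc flip: mterm_minus)
  show "1 \<le> i \<Longrightarrow> k \<le> j \<Longrightarrow> mterm c i j l \<in> I"
    unfolding I_def using nz
    by (intro jacobian_idealI[of _ 0 _ "mterm (c / ?\<kappa>) (i - 1) (j - k) l" 0])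
      (simp add: pdiff_free_curve mterm_mult)
  show "k + 1 \<le> i \<Longrightarrow> mterm c i j l \<in> I"
    unfolding I_def
    by (intro jacobian_idealI[of _ 0 _ 0 "mterm c (i - (k + 1)) j l"])
      (simp add: pdiff_free_curve mterm_mult)
  show "1 \<le> k \<Longrightarrow> 2 * k + 1 \<le> j \<Longrightarrow> mterm c i j l \<in> I"
    unfolding I_def
    by (intro jacobian_idealI[of _ "mterm c i (j - (k + 1)) l" _
          "mterm (- c) (i + k - 1) (j - (k + 1) - k) (l + 1)" 0])
      (simp add: pdiff_free_curve mterm_mult distrib_left add_ac mult.commute flip: mterm_minus)
qed

text \<open>
  The local algebra is \<open>k[x, y] / (x y\<^sup>k, (k + 1) x\<^sup>k + y\<^sup>k\<^sup>+\<^sup>1)\<close>. A basis consists of \<open>x\<^sup>i y\<^sup>j\<close> with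
  \<open>1 \<le> i < k\<close> and \<open>j < k\<close> together with \<open>1, y, \<dots>, y\<^sup>2\<^sup>k\<close>. The socle is spanned by \<open>y\<^sup>2\<^sup>k\<close>, which equals
  \<open>- (k + 1) x\<^sup>k y\<^sup>k\<^sup>-\<^sup>1\<close>. This forces the two nonzero values of the linear form, up to scaling, and
  each basis monomial is paired with its complement in the one of the two socle monomials that involves
  \<open>x\<close> exactly when the basis monomial does.
\<close>

lemma tjurina_number_free_curve:
  assumes "1 \<le> k"
  shows "tjurina_number (free_curve k :: 'k::field_char_0 mpoly3) = k * (k + 1) + 1"
proof -
  let ?I = "jacobian_ideal (free_curve k :: 'k mpoly3)"
  let ?B = "({1..<k} \<times> {..<k}) \<union> ({0} \<times> {..2 * k})"
  let ?\<kappa> = "of_nat (k + 1) :: 'k"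
  have nz: "?\<kappa> \<noteq> 0" unfolding of_nat_eq_0_iff by simp
  define t where "t = (\<lambda>i j. if i = 0 \<and> j = 2 * k then ?\<kappa> else if i = k \<and> j = k - 1 then - 1 else 0)"
  define dual where "dual = (\<lambda>(i, j). if i = 0 then (0, 2 * k - j) else (k - i, k - 1 - j))"
  interpret punctual_ideal ?I "2 * k + 1"
    using assms by (intro punctual_jacobian_ideal) (simp_all add: jacobian_ideal_free_curve)
  interpret punctual_ideal_with_dual_basis ?I "2 * k + 1" ?B t dual "2 * k"
  proof
    show "finite ?B" by simp
    show "fst b + snd b \<le> 2 * k" if "b \<in> ?B" for b using that by auto
    show "pairing t f = 0" if "f \<in> ?I" for f
    proof (rule pairing_jacobian_ideal_eq_0[OF that])
      fix i j l :: nat and v :: 3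
      show "pairing t (mterm 1 i j l * pdiff v (free_curve k)) = 0"
        using exhaust_3[of v] assms
        by (auto simp: pdiff_free_curve mterm_mult distrib_left pairing_add pairing_mterm t_def)
    qed
    show "t (fst b + fst (dual b')) (snd b + snd (dual b')) = 0 \<longleftrightarrow> b \<noteq> b'"
      if "b \<in> ?B" "b' \<in> ?B" for b b'
      using that nz by (cases b; cases b') (auto simp: t_def dual_def simp del: of_nat_add)
    show "\<exists>b\<in>?B. \<exists>c. \<forall>l. 2 * k \<le> i + j + l \<longrightarrow>
      mterm 1 i j (l + 1) - mterm c (fst b) (snd b) (i + j + l + 1 - (fst b + snd b)) \<in> ?I" for i j
    proof -
      consider "(i, j) \<in> ?B" | "i = k" "j < k" | "1 \<le> i" "k \<le> j" | "k + 1 \<le> i" | "2 * k + 1 \<le> j"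
        by force
      then show ?thesis
      proof cases
        case 1
        then show ?thesis by (intro bexI[of _ "(i, j)"] exI[of _ 1]) (simp_all add: zero_mem)
      next
        case 2
        have "(0, k + 1 + j) \<in> ?B" using 2 by simp
        then show ?thesis
          using jacobian_ideal_free_curve(1)[where ?'k = 'k, of k j] 2
          by (intro bexI[of _ "(0, k + 1 + j)"] exI[of _ "- 1 / ?\<kappa>"]) (simp_all del: of_nat_add)
      next
        case 3
        then show ?thesis
          by (intro bexI[of _ "(0, 0)"] exI[of _ 0]) (simp_all add: jacobian_ideal_free_curve)
      next
        case 4
        then show ?thesis
          by (intro bexI[of _ "(0, 0)"] exI[of _ 0]) (simp_all add: jacobian_ideal_free_curve)
      next
        case 5
        then show ?thesis using assms
          by (intro bexI[of _ "(0, 0)"] exI[of _ 0]) (simp_all add: jacobian_ideal_free_curve)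
      qed
    qed
  qed
  have "card ?B = card ({1..<k} \<times> {..<k}) + card ({0::nat} \<times> {..2 * k})"
    by (rule card_Un_disjoint) auto
  also have "\<dots> = k * (k + 1) + 1"
    using assms by (cases k) (simp_all add: card_cartesian_product)
  finally show ?thesis unfolding tjurina_number_def h0_eq_card .
qed

text \<open>
  The syzygy of degree one is \<open>x f\<^sub>x - y f\<^sub>y / (k + 1) - (k + 1) z f\<^sub>z = 0\<close>.
\<close>

lemma min_syzygy_degree_free_curve:
  assumes "1 \<le> k"
  shows "min_syzygy_degree (free_curve k :: 'k::field_char_0 mpoly3) = 1"
proof (rule min_syzygy_degree_eq_1)
  let ?\<kappa> = "of_nat (k + 1) :: 'k"
  have nz: "?\<kappa> \<noteq> 0" unfolding of_nat_eq_0_iff by simp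
  let ?a = "(\<chi> i. if i = 1 then mterm 1 1 0 0 else if i = 2 then mterm (- 1 / ?\<kappa>) 0 1 0
    else mterm (- ?\<kappa>) 0 0 1) :: 'k mpoly3 ^ 3"
  show "?a \<in> syzygies (free_curve k) 1"
    using nz by (simp add: syzygies_def sum_3 pdiff_free_curve distrib_left mterm_mult
        homogeneous_mterm homogeneous_minus del: of_nat_add of_nat_Suc flip: mterm_minus)
  have "?a $ 1 \<noteq> 0" by simp
  then show "?a \<noteq> 0" by (metis zero_index)
next
  fix p q r :: 'k
  let ?s = "mterm p 0 0 0 * pdiff 1 (free_curve k) + mterm q 0 0 0 * pdiff 2 (free_curve k) +
      mterm r 0 0 0 * pdiff 3 (free_curve k)"
  have nz: "of_nat (k + 1) \<noteq> (0::'k)" unfolding of_nat_eq_0_iff by simp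
  assume "?s = 0"
  then have "Poly_Mapping.lookup ?s m = 0" for m by simp
  from this[of "expo 0 (k + 1) 0"] this[of "expo 1 k 0"] this[of "expo (k + 1) 0 0"]
  show "p = 0 \<and> q = 0 \<and> r = 0"
    using nz assms by (simp add: pdiff_free_curve mterm_mult distrib_left lookup_add lookup_mterm
        del: of_nat_add of_nat_Suc)
qed

section \<open>Sharpness of both bounds\<close>

theorem proposition22:
  fixes d :: nat
  assumes "d \<ge> 3"
  shows "(\<exists>f :: 'k::{alg_closed_field, field_char_0} mpoly3.
            reduced_singular_curve d f \<and> min_syzygy_degree f \<ge> 1 \<and>
            int (tjurina_number f) = (int d - 1) * (int d - min_syzygy_degree f - 1)) \<and>
         (\<exists>f :: 'k mpoly3.
            reduced_singular_curve d f \<and> min_syzygy_degree f \<ge> 1 \<and>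
            int (tjurina_number f) = (int d - 1) * (int d - min_syzygy_degree f - 1)
                                       + (min_syzygy_degree f)\<^sup>2)"
proof (intro conjI exI)
  define k where "k = d - 2"
  have k: "1 \<le> k" and d: "d = k + 1 + 1" using assms by (simp_all add: k_def)
  show "reduced_singular_curve d (cuspidal_curve k :: 'k mpoly3)"
    unfolding d cuspidal_curve_def using k by (intro reduced_singular_binomial) simp_all
  show "reduced_singular_curve d (free_curve k :: 'k mpoly3)"
    unfolding d free_curve_def using k by (intro reduced_singular_binomial) simp_all
  show "min_syzygy_degree (cuspidal_curve k :: 'k mpoly3) \<ge> 1"
    "min_syzygy_degree (free_curve k :: 'k mpoly3) \<ge> 1"
    using k by (simp_all add: min_syzygy_degree_cuspidal_curve min_syzygy_degree_free_curve)
  show "int (tjurina_number (cuspidal_curve k :: 'k mpoly3)) =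
      (int d - 1) * (int d - min_syzygy_degree (cuspidal_curve k :: 'k mpoly3) - 1)"
    using k by (simp add: tjurina_number_cuspidal_curve min_syzygy_degree_cuspidal_curve d algebra_simps)
  show "int (tjurina_number (free_curve k :: 'k mpoly3)) =
      (int d - 1) * (int d - min_syzygy_degree (free_curve k :: 'k mpoly3) - 1)
        + (min_syzygy_degree (free_curve k :: 'k mpoly3))\<^sup>2"
    using k by (simp add: tjurina_number_free_curve min_syzygy_degree_free_curve d algebra_simps)
qed

end
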